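(* Iterative-Local-Backbone restricted to definite Horn formulas is solvable in polynomial time.
   Context: A clause is a finite set of literals not containing both $x$ and $\neg x$; the complement $\overline{l}$ of $x$ is $\neg x$ and vice versa. A CNF formula is a finite set of clauses, $|\varphi|$ its number of clauses, $\mathrm{Var}(\varphi)$ its variables. A definite Horn formula consists of clauses each containing exactly one positive literal. For a literal $l$, the reduct $\varphi|_l$ is obtained by deleting all clauses containing $l$ and removing $\overline{l}$ from the remaining clauses. $\varphi\models\psi$ means every assignment satisfying $\varphi$ satisfies $\psi$. A variable $x$ is a $k$-backbone of $\varphi$ if there is $\varphi'\subseteq\varphi$ with $|\varphi'|\le k$ and $\varphi'\models x$ or $\varphi'\models\neg x$. A variable $x$ is an iterative $k$-backbone of $\varphi$ if either (i) $x$ is a $k$-backbone of $\varphi$, or (ii) there is $y\in\mathrm{Var}(\varphi)$ that is a $k$-backbone of $\varphi$ and $l\in\{y,\neg y\}$ with $\varphi\models l$ such that $x$ is an iterative $k$-backbone of $\varphi|_l$. Iterative-Local-Backbone$[\mathcal{C}]$: given $\varphi\in\mathcal{C}$, a variable $x$ of $\varphi$, and $k\ge1$, decide whether $x$ is an iterative $k$-backbone of $\varphi$. *)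

theory Defs
  imports Main "HOL-Computational_Algebra.Polynomial"
begin

section \<open>CNF formulas and local backbones\<close>

datatype 'v lit = Pos 'v | Neg 'v

primrec var :: "'v lit \<Rightarrow> 'v" where
  "var (Pos v) = v"
| "var (Neg v) = v"

primrec compl :: "'v lit \<Rightarrow> 'v lit" where
  "compl (Pos v) = Neg v"
| "compl (Neg v) = Pos v"

type_synonym 'v clause = "'v lit set"
type_synonym 'v formula = "'v clause set"

definition is_clause :: "'v clause \<Rightarrow> bool" where
  "is_clause C \<longleftrightarrow> finite C \<and> (\<forall>v. \<not> (Pos v \<in> C \<and> Neg v \<in> C))"

definition is_cnf :: "'v formula \<Rightarrow> bool" where
  "is_cnf \<phi> \<longleftrightarrow> finite \<phi> \<and> (\<forall>C\<in>\<phi>. is_clause C)"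

definition Vars :: "'v formula \<Rightarrow> 'v set" where
  "Vars \<phi> = (\<Union>C\<in>\<phi>. var ` C)"

definition definite_Horn :: "'v formula set" where
  "definite_Horn = {\<phi>. is_cnf \<phi> \<and> (\<forall>C\<in>\<phi>. \<exists>!v. Pos v \<in> C)}"

definition reduct :: "'v formula \<Rightarrow> 'v lit \<Rightarrow> 'v formula" where
  "reduct \<phi> l = (\<lambda>C. C - {compl l}) ` {C \<in> \<phi>. l \<notin> C}"

primrec sat_lit :: "('v \<Rightarrow> bool) \<Rightarrow> 'v lit \<Rightarrow> bool" where
  "sat_lit \<tau> (Pos v) \<longleftrightarrow> \<tau> v"
| "sat_lit \<tau> (Neg v) \<longleftrightarrow> \<not> \<tau> v"

definition satisfies :: "('v \<Rightarrow> bool) \<Rightarrow> 'v formula \<Rightarrow> bool" where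
  "satisfies \<tau> \<phi> \<longleftrightarrow> (\<forall>C\<in>\<phi>. \<exists>l\<in>C. sat_lit \<tau> l)"

definition entails :: "'v formula \<Rightarrow> 'v formula \<Rightarrow> bool" where
  "entails \<phi> \<psi> \<longleftrightarrow> (\<forall>\<tau>. satisfies \<tau> \<phi> \<longrightarrow> satisfies \<tau> \<psi>)"

text \<open>A literal \<open>l\<close> on the right of an entailment is read as the formula \<open>{{l}}\<close>.\<close>

definition k_backbone :: "nat \<Rightarrow> 'v formula \<Rightarrow> 'v \<Rightarrow> bool" where
  "k_backbone k \<phi> x \<longleftrightarrow>
     (\<exists>\<phi>'. \<phi>' \<subseteq> \<phi> \<and> finite \<phi>' \<and> card \<phi>' \<le> k \<and>
        (entails \<phi>' {{Pos x}} \<or> entails \<phi>' {{Neg x}}))"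

inductive iterative_k_backbone :: "nat \<Rightarrow> 'v formula \<Rightarrow> 'v \<Rightarrow> bool" for k :: nat where
  base: "k_backbone k \<phi> x \<Longrightarrow> iterative_k_backbone k \<phi> x"
| step: "y \<in> Vars \<phi> \<Longrightarrow> k_backbone k \<phi> y \<Longrightarrow> l \<in> {Pos y, Neg y} \<Longrightarrow> entails \<phi> {{l}} \<Longrightarrow>
         iterative_k_backbone k (reduct \<phi> l) x \<Longrightarrow> iterative_k_backbone k \<phi> x"


section \<open>The decision problem as a language\<close>

datatype sym = Bit0 | Bit1 | Plus | Minus | ClauseEnd | Sep

instance sym :: finite
proof
  have "(UNIV :: sym set) = {Bit0, Bit1, Plus, Minus, ClauseEnd, Sep}"
    using sym.exhaust by auto
  then show "finite (UNIV :: sym set)"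
    by (metis finite.emptyI finite_insert)
qed

text \<open>
  Binary notation, least significant bit first and without superfluous zero bits;
  in particular zero is the empty string.
\<close>

fun enc_nat :: "nat \<Rightarrow> sym list" where
  "enc_nat n = (if n = 0 then [] else (if odd n then Bit1 else Bit0) # enc_nat (n div 2))"

declare enc_nat.simps [simp del]

primrec enc_lit :: "nat lit \<Rightarrow> sym list" where
  "enc_lit (Pos v) = Plus # enc_nat v"
| "enc_lit (Neg v) = Minus # enc_nat v"

definition enc_clause :: "nat lit list \<Rightarrow> sym list" where
  "enc_clause ls = concat (map enc_lit ls) @ [ClauseEnd]"

definition enc_instance :: "nat lit list list \<Rightarrow> nat \<Rightarrow> nat \<Rightarrow> sym list" where
  "enc_instance cls x k = concat (map enc_clause cls) @ [Sep] @ enc_nat x @ [Sep] @ enc_nat k"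

definition formula_of :: "nat lit list list \<Rightarrow> nat formula" where
  "formula_of cls = set (map set cls)"

text \<open>
  A formula may be presented by any list of lists of literals that enumerates it, in any
  order and possibly with repetitions.  Strings that are not the encoding of an instance
  (a formula in \<open>\<C>\<close>, one of its variables, and a number \<open>k \<ge> 1\<close>) are not in the language,
  so a decision procedure has to reject them.
\<close>

definition Iterative_Local_Backbone :: "nat formula set \<Rightarrow> sym list set" where
  "Iterative_Local_Backbone \<C> =
     {enc_instance cls x k | cls x k.
        is_cnf (formula_of cls) \<and> formula_of cls \<in> \<C> \<and> x \<in> Vars (formula_of cls) \<and> k \<ge> 1 \<and>
        iterative_k_backbone k (formula_of cls) x}"


section \<open>Polynomial time on deterministic multi-tape Turing machines\<close>

text \<open>
  Tapes are infinite in both directions.  A machine uses the blank, the input alphabet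
  (the finite type \<open>'a\<close>) and finitely many auxiliary symbols \<open>Aux 0, \<dots>, Aux (n - 1)\<close>.
\<close>

datatype 'a cell = Blank | Inp 'a | Aux nat

datatype move = MoveLeft | Stay | MoveRight

primrec offset :: "move \<Rightarrow> int" where
  "offset MoveLeft = -1"
| "offset Stay = 0"
| "offset MoveRight = 1"

record 'a tm =
  num_tapes :: nat
  num_aux :: nat
  num_states :: nat
  start_state :: nat
  accept_state :: nat
  reject_state :: nat
  delta :: "nat \<Rightarrow> 'a cell list \<Rightarrow> nat \<times> ('a cell \<times> move) list"

definition tape_symbols :: "'a tm \<Rightarrow> 'a cell set" where
  "tape_symbols M = {Blank} \<union> range Inp \<union> Aux ` {..<num_aux M}"

definition turing_machine :: "'a tm \<Rightarrow> bool" where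
  "turing_machine M \<longleftrightarrow>
     num_tapes M \<ge> 1 \<and>
     start_state M < num_states M \<and> accept_state M < num_states M \<and>
     reject_state M < num_states M \<and> accept_state M \<noteq> reject_state M \<and>
     (\<forall>q < num_states M. \<forall>ss. length ss = num_tapes M \<and> set ss \<subseteq> tape_symbols M \<longrightarrow>
        (case delta M q ss of (q', acts) \<Rightarrow>
           q' < num_states M \<and> length acts = num_tapes M \<and> fst ` set acts \<subseteq> tape_symbols M))"

type_synonym 'a tape = "(int \<Rightarrow> 'a cell) \<times> int"
type_synonym 'a config = "nat \<times> 'a tape list"

fun read_tape :: "'a tape \<Rightarrow> 'a cell" where
  "read_tape (t, h) = t h"

fun act_tape :: "'a cell \<times> move \<Rightarrow> 'a tape \<Rightarrow> 'a tape" where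
  "act_tape (s, m) (t, h) = (t(h := s), h + offset m)"

definition halted :: "'a tm \<Rightarrow> 'a config \<Rightarrow> bool" where
  "halted M c \<longleftrightarrow> fst c \<in> {accept_state M, reject_state M}"

definition step :: "'a tm \<Rightarrow> 'a config \<Rightarrow> 'a config" where
  "step M c =
     (if halted M c then c
      else case delta M (fst c) (map read_tape (snd c)) of
        (q', acts) \<Rightarrow> (q', map2 act_tape acts (snd c)))"

definition blank_tape :: "'a tape" where
  "blank_tape = (\<lambda>_. Blank, 0)"

definition input_tape :: "'a list \<Rightarrow> 'a tape" where
  "input_tape w = (\<lambda>i. if 0 \<le> i \<and> i < int (length w) then Inp (w ! nat i) else Blank, 0)"

definition init_config :: "'a tm \<Rightarrow> 'a list \<Rightarrow> 'a config" where
  "init_config M w = (start_state M, input_tape w # replicate (num_tapes M - 1) blank_tape)"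

definition decides_in_time :: "'a tm \<Rightarrow> 'a list set \<Rightarrow> (nat \<Rightarrow> nat) \<Rightarrow> bool" where
  "decides_in_time M L T \<longleftrightarrow>
     (\<forall>w. \<exists>n \<le> T (length w). 
        fst ((step M ^^ n) (init_config M w)) = (if w \<in> L then accept_state M else reject_state M))"

definition polynomial_time :: "'a::finite list set set" where
  "polynomial_time =
     {L. \<exists>M (p :: nat poly). turing_machine M \<and> decides_in_time M L (poly p)}"

end

(*
  A definite Horn formula is satisfied by the all-true assignment, so an iterative k-backbone of it
  is an entailed variable. Conversely, if a definite Horn formula entails x, then it contains a unit
  clause {y} (otherwise the all-false assignment would be a model); y is a 1-backbone, and after
  reducing by y the formula still entails x or x = y. Hence for every k >= 1 the iterative
  k-backbones are exactly the entailed variables, and these are computed by forward chaining, which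
  is stationary after as many rounds as there are clauses.

  Forward chaining is programmed in a small imperative language on a fixed number of stacks. Such a
  program is run step by step by a Turing machine with one tape per stack whose states are the
  possible continuations of the program.
*)

theory Submission
  imports Defs
begin

section \<open>Stack programs and their Turing machines\<close>

text \<open>Two features of the language shape the program. Moreover guards and pushed symbols
  depend on stack tops only, so that a transition depends on the control state and the scanned
  cells. Reading a stack therefore consumes it, and every lookup has to save what it reads and put
  it back.

  The degree of the final bound comes from nested loops and from a list of derived variables that
  keeps repetitions. On data of size \<open>m\<close> a lookup costs order \<open>m^2\<close>, a
  clause looks up each of its negative literals for \<open>m^3\<close>, and a round over all clauses
  costs \<open>m^4\<close>. The list grows by at most the input length \<open>n\<close> per round,
  so \<open>m = n * n + n\<close> over all \<open>n\<close> rounds, which gives degree 8 for one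
  round and 9 in total.\<close>

datatype 'a com =
    Skip
  | Push nat "(nat \<Rightarrow> 'a option) \<Rightarrow> 'a"
  | Pop nat
  | Seq "'a com" "'a com"  (infixr ";;" 60)
  | Cond "(nat \<Rightarrow> 'a option) \<Rightarrow> bool" "'a com" "'a com"
  | Loop "(nat \<Rightarrow> 'a option) \<Rightarrow> bool" "'a com"

type_synonym 'a stacks = "nat \<Rightarrow> 'a list"

definition tops :: "'a stacks \<Rightarrow> nat \<Rightarrow> 'a option" where
  "tops s i = (case s i of [] \<Rightarrow> None | a # _ \<Rightarrow> Some a)"

text \<open>The number counts Turing machine steps; a push takes two, since the head has to move to a
  fresh cell before writing.\<close>

inductive exec :: "'a com \<Rightarrow> 'a stacks \<Rightarrow> nat \<Rightarrow> 'a stacks \<Rightarrow> bool" where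
  Skip: "exec Skip s 1 s"
| Push: "exec (Push i f) s 2 (s(i := f (tops s) # s i))"
| Pop: "exec (Pop i) s 1 (s(i := tl (s i)))"
| Seq: "exec c s t s' \<Longrightarrow> exec d s' u s'' \<Longrightarrow> exec (c ;; d) s (1 + (t + u)) s''"
| CondT: "b (tops s) \<Longrightarrow> exec c s t s' \<Longrightarrow> exec (Cond b c d) s (1 + t) s'"
| CondF: "\<not> b (tops s) \<Longrightarrow> exec d s t s' \<Longrightarrow> exec (Cond b c d) s (1 + t) s'"
| LoopF: "\<not> b (tops s) \<Longrightarrow> exec (Loop b c) s 1 s"
| LoopT: "b (tops s) \<Longrightarrow> exec c s t s' \<Longrightarrow> exec (Loop b c) s' u s'' \<Longrightarrow>
          exec (Loop b c) s (1 + (t + u)) s''"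

primrec regs :: "'a com \<Rightarrow> nat set" where
  "regs Skip = {}"
| "regs (Push i f) = {i}"
| "regs (Pop i) = {i}"
| "regs (c ;; d) = regs c \<union> regs d"
| "regs (Cond b c d) = regs c \<union> regs d"
| "regs (Loop b c) = regs c"

text \<open>Control states are the commands that remain to be executed; \<open>Put\<close> is the middle of a push.\<close>

datatype 'a ctl = Run "'a com list" | Put nat 'a "'a com list" | Acc | Rej

type_synonym 'a action = "nat \<Rightarrow> 'a cell \<Rightarrow> 'a cell \<times> move"

definition keep :: "'a action" where
  "keep i x = (x, Stay)"

fun next_ctl :: "((nat \<Rightarrow> 'a option) \<Rightarrow> bool) \<Rightarrow> 'a ctl \<Rightarrow> (nat \<Rightarrow> 'a option) \<Rightarrow> 'a ctl \<times> 'a action" where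
  "next_ctl acc (Run []) tp = (if acc tp then Acc else Rej, keep)"
| "next_ctl acc (Run (Skip # K)) tp = (Run K, keep)"
| "next_ctl acc (Run (Push i f # K)) tp = (Put i (f tp) K, keep(i := \<lambda>x. (x, MoveLeft)))"
| "next_ctl acc (Run (Pop i # K)) tp = (Run K, keep(i := \<lambda>x. (x, MoveRight)))"
| "next_ctl acc (Run ((c ;; d) # K)) tp = (Run (c # d # K), keep)"
| "next_ctl acc (Run (Cond b c d # K)) tp = (Run ((if b tp then c else d) # K), keep)"
| "next_ctl acc (Run (Loop b c # K)) tp = (Run (if b tp then c # Loop b c # K else K), keep)"
| "next_ctl acc (Put i a K) tp = (Run K, keep(i := \<lambda>_. (Inp a, Stay)))"
| "next_ctl acc Acc tp = (Acc, keep)"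
| "next_ctl acc Rej tp = (Rej, keep)"

text \<open>The continuations reachable while executing \<open>c\<close> in front of \<open>K\<close>: finitely many, because the
  continuation of a loop body contains the loop itself again.\<close>

fun conts :: "'a com \<Rightarrow> 'a com list \<Rightarrow> 'a com list set" where
  "conts Skip K = {Skip # K}"
| "conts (Push i f) K = {Push i f # K}"
| "conts (Pop i) K = {Pop i # K}"
| "conts (c ;; d) K = insert ((c ;; d) # K) (conts c (d # K) \<union> conts d K)"
| "conts (Cond b c d) K = insert (Cond b c d # K) (conts c K \<union> conts d K)"
| "conts (Loop b c) K = insert (Loop b c # K) (conts c (Loop b c # K))"

text \<open>An overapproximation of \<open>next_ctl\<close> that forgets the guards. A push is
  treated as passing to \<open>K\<close> at once; its intermediate state is covered by
  \<open>put_ctls\<close>.\<close>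

fun next_conts :: "'a com list \<Rightarrow> 'a com list set" where
  "next_conts [] = {}"
| "next_conts ((c ;; d) # K) = {c # d # K}"
| "next_conts (Cond b c d # K) = {c # K, d # K}"
| "next_conts (Loop b c # K) = {c # Loop b c # K, K}"
| "next_conts (c # K) = {K}"

lemma finite_conts: "finite (conts c K)"
  by (induction c arbitrary: K) auto

lemma Cons_in_conts: "c # K \<in> conts c K"
  by (cases c) auto

text \<open>The only exit from \<open>conts c K\<close> is \<open>K\<close>. For a subcommand the
  hypothesis is used with its own continuation, \<open>d # K\<close> for the first half of a
  sequence and the loop itself for a loop body, and these lie in the larger set again.\<close>

lemma next_conts_subset: "L \<in> conts c K \<Longrightarrow> next_conts L \<subseteq> insert K (conts c K)"
proof (induction c arbitrary: L K)
  case (Seq c d)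
  from Seq.prems consider "L = (c ;; d) # K" | "L \<in> conts c (d # K)" | "L \<in> conts d K" by auto
  then show ?case
  proof cases
    case 1 then show ?thesis using Cons_in_conts[of c "d # K"] by auto
  next
    case 2 then show ?thesis using Seq.IH(1)[OF 2] Cons_in_conts[of d K] by auto
  next
    case 3 then show ?thesis using Seq.IH(2)[OF 3] by auto
  qed
next
  case (Cond b c d)
  from Cond.prems consider "L = Cond b c d # K" | "L \<in> conts c K" | "L \<in> conts d K" by auto
  then show ?case
  proof cases
    case 1 then show ?thesis using Cons_in_conts[of c K] Cons_in_conts[of d K] by auto
  next
    case 2 then show ?thesis using Cond.IH(1)[OF 2] by auto
  next
    case 3 then show ?thesis using Cond.IH(2)[OF 3] by auto
  qed
next
  case (Loop b c)
  from Loop.prems consider "L = Loop b c # K" | "L \<in> conts c (Loop b c # K)" by auto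
  then show ?case
  proof cases
    case 1 then show ?thesis using Cons_in_conts[of c "Loop b c # K"] by auto
  next
    case 2 then show ?thesis using Loop.IH[OF 2] by auto
  qed
qed auto

text \<open>Serves the sequence case of the simulation: after its first half the machine is in
  \<open>d # K\<close>, which is not an immediate successor of the sequence in
  \<open>next_conts\<close>.\<close>

lemma tail_in_conts:
  "c # K \<in> conts c0 J \<Longrightarrow> K \<in> insert J (conts c0 J)"
proof (induction c0 arbitrary: J)
  case (Seq a b) then show ?case using Cons_in_conts[of b J] by fastforce
next
  case (Loop g a) then show ?case by fastforce
qed auto

definition put_ctls :: "'a com list \<Rightarrow> 'a ctl set" where
  "put_ctls L = {Put i a K | i a f K. L = Push i f # K}"

definition ctls :: "'a com \<Rightarrow> 'a ctl set" where
  "ctls c = (let S = insert [] (conts c []) in Run ` S \<union> (\<Union>L\<in>S. put_ctls L) \<union> {Acc, Rej})"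

lemma finite_put_ctls: "finite (put_ctls (L :: 'a::finite com list))"
proof (cases "\<exists>i f K. L = Push i f # K")
  case True
  then obtain i f K where L: "L = Push i f # K" by blast
  have "put_ctls L = (\<lambda>a. Put i a K) ` UNIV"
    unfolding put_ctls_def L by auto
  then show ?thesis by simp
next
  case False
  then have "put_ctls L = {}" unfolding put_ctls_def by auto
  then show ?thesis by simp
qed

lemma finite_ctls: "finite (ctls (c :: 'a::finite com))"
  unfolding ctls_def Let_def by (simp add: finite_conts finite_put_ctls)

lemma Run_in_ctls: "Run K \<in> ctls c \<longleftrightarrow> K \<in> insert [] (conts c [])"
  unfolding ctls_def Let_def put_ctls_def by auto

lemma next_conts_closed:
  assumes "K \<in> insert [] (conts c [])" shows "next_conts K \<subseteq> insert [] (conts c [])"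
  using assms next_conts_subset[of K c "[]"] by auto

lemma next_ctl_in_ctls:
  assumes "q \<in> ctls c" shows "fst (next_ctl acc q tp) \<in> ctls c"
proof (cases q)
  case (Run L)
  have L: "L \<in> insert [] (conts c [])" using assms Run Run_in_ctls by blast
  have cl: "next_conts L \<subseteq> insert [] (conts c [])" using next_conts_closed[OF L] .
  show ?thesis
  proof (cases L)
    case Nil then show ?thesis using Run by (auto simp: ctls_def Let_def)
  next
    case (Cons d K)
    show ?thesis
    proof (cases d)
      case (Push i f)
      have "Put i (f tp) K \<in> put_ctls L" unfolding put_ctls_def using Cons Push by auto
      then show ?thesis using Run Cons Push L unfolding ctls_def Let_def by auto
    qed (use Run Cons cl in \<open>auto simp: Run_in_ctls\<close>)
  qed
next
  case (Put i a K)
  obtain f where "Push i f # K \<in> insert [] (conts c [])"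
    using assms Put unfolding ctls_def Let_def put_ctls_def by auto
  from next_conts_closed[OF this] show ?thesis using Put by (auto simp: Run_in_ctls)
qed (use assms in auto)

section \<open>Simulation of stacks on tapes\<close>

definition tops_of_cells :: "'a cell list \<Rightarrow> nat \<Rightarrow> 'a option" where
  "tops_of_cells ss i = (if i < length ss then (case ss ! i of Inp a \<Rightarrow> Some a | _ \<Rightarrow> None) else None)"

text \<open>States of a \<open>tm\<close> are numbers, so \<open>e\<close> numbers the control
  states and \<open>inv_into\<close> decodes them. Stacks use the input alphabet and the blank marks
  their bottom, hence no auxiliary symbols.\<close>

definition machine :: "nat \<Rightarrow> 'a com \<Rightarrow> ((nat \<Rightarrow> 'a option) \<Rightarrow> bool) \<Rightarrow> ('a ctl \<Rightarrow> nat) \<Rightarrow> 'a tm" where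
  "machine n c acc e =
     \<lparr>num_tapes = n, num_aux = 0, num_states = card (ctls c),
      start_state = e (Run [c]), accept_state = e Acc, reject_state = e Rej,
      delta = (\<lambda>q ss. case next_ctl acc (inv_into (ctls c) e q) (tops_of_cells ss) of
                 (q', act) \<Rightarrow> (e q', map (\<lambda>i. act i (ss ! i)) [0..<n]))\<rparr>"

text \<open>The top of the stack is at the head and the stack extends to the right; cells to the left are
  arbitrary, so popping need not erase.\<close>

definition tape_holds :: "'a tape \<Rightarrow> 'a list \<Rightarrow> bool" where
  "tape_holds T xs \<longleftrightarrow>
     (\<forall>j. fst T (snd T + int j) = (if j < length xs then Inp (xs ! j) else Blank))"

text \<open>Stacks without a tape are required to be empty, to agree with
  \<open>tops_of_cells\<close>, which yields \<open>None\<close> there.\<close>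

definition tapes_hold :: "nat \<Rightarrow> 'a tape list \<Rightarrow> 'a stacks \<Rightarrow> bool" where
  "tapes_hold n Ts s \<longleftrightarrow>
     length Ts = n \<and> (\<forall>i<n. tape_holds (Ts ! i) (s i)) \<and> (\<forall>i\<ge>n. s i = [])"

lemma next_ctl_cells:
  assumes "x \<in> tape_symbols M"
  shows "fst (snd (next_ctl acc q tp) i x) \<in> tape_symbols M"
  using assms
  by (cases "(acc, q, tp)" rule: next_ctl.cases) (auto simp: keep_def tape_symbols_def)

lemma turing_machine_machine:
  fixes c :: "'a::finite com"
  assumes e: "bij_betw e (ctls c) {..<card (ctls c)}" and n: "n \<ge> 1"
  shows "turing_machine (machine n c acc e)"
proof -
  let ?M = "machine n c acc e"
  have lt: "e q < card (ctls c)" if "q \<in> ctls c" for q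
    using e that unfolding bij_betw_def by auto
  have ne: "e Acc \<noteq> e Rej"
    using e unfolding bij_betw_def inj_on_def by (force simp: ctls_def Let_def)
  have st: "Run [c] \<in> ctls c" "Acc \<in> ctls c" "Rej \<in> ctls c"
    using Cons_in_conts[of c "[]"] by (auto simp: Run_in_ctls) (auto simp: ctls_def Let_def)
  have "case delta ?M q ss of (q', acts) \<Rightarrow>
           q' < num_states ?M \<and> length acts = num_tapes ?M \<and> fst ` set acts \<subseteq> tape_symbols ?M"
    if q: "q < num_states ?M" and len: "length ss = num_tapes ?M" and ss: "set ss \<subseteq> tape_symbols ?M"
    for q ss
  proof -
    have "inv_into (ctls c) e q \<in> ctls c"
      using q e by (auto simp: machine_def bij_betw_def intro: inv_into_into)
    then have 1: "fst (next_ctl acc (inv_into (ctls c) e q) (tops_of_cells ss)) \<in> ctls c"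
      by (rule next_ctl_in_ctls)
    obtain q' act where na: "next_ctl acc (inv_into (ctls c) e q) (tops_of_cells ss) = (q', act)"
      by fastforce
    have dl: "delta ?M q ss = (e q', map (\<lambda>i. act i (ss ! i)) [0..<n])"
      using na by (simp add: machine_def)
    have cells: "fst (act i (ss ! i)) \<in> tape_symbols ?M" if "i < n" for i
    proof -
      have "ss ! i \<in> tape_symbols ?M" using that len ss by (auto simp: machine_def)
      from next_ctl_cells[OF this, of acc "inv_into (ctls c) e q" "tops_of_cells ss" i] na
      show ?thesis by simp
    qed
    have "e q' < card (ctls c)" using 1 na lt by simp
    then show ?thesis using cells by (auto simp: dl) (auto simp: machine_def)
  qed
  then show ?thesis
    unfolding turing_machine_def using n ne lt st by (auto simp: machine_def)
qed

lemma tops_read: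
  assumes "tapes_hold n Ts s"
  shows "tops_of_cells (map read_tape Ts) = tops s"
proof
  fix i
  show "tops_of_cells (map read_tape Ts) i = tops s i"
  proof (cases "i < n")
    case True
    then have "tape_holds (Ts ! i) (s i)" "length Ts = n" using assms by (auto simp: tapes_hold_def)
    then have "fst (Ts ! i) (snd (Ts ! i)) = (if 0 < length (s i) then Inp (s i ! 0) else Blank)"
      unfolding tape_holds_def by (metis add.right_neutral of_nat_0)
    then show ?thesis using True \<open>length Ts = n\<close>
      by (cases "Ts ! i"; cases "s i") (auto simp: tops_of_cells_def tops_def)
  next
    case False
    then show ?thesis using assms by (auto simp: tops_of_cells_def tops_def tapes_hold_def)
  qed
qed

text \<open>Shaped after the costs in \<open>exec\<close>: one step unfolds the command, two runs
  follow. Conditionals use it with \<open>u = 0\<close>.\<close>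

lemma funpow_chain:
  assumes "f x = y" "(f ^^ t) y = z" "(f ^^ u) z = z'"
  shows "(f ^^ (1 + (t + u))) x = z'"
  using assms by (simp add: funpow_add funpow_swap1 add.commute[of t u])

context
  fixes n :: nat and c0 :: "'a::finite com" and acc :: "(nat \<Rightarrow> 'a option) \<Rightarrow> bool" and e :: "'a ctl \<Rightarrow> nat"
  assumes e: "bij_betw e (ctls c0) {..<card (ctls c0)}"
begin

abbreviation "\<M> \<equiv> machine n c0 acc e"

lemma step_machine:
  assumes q: "q \<in> ctls c0" "q \<noteq> Acc" "q \<noteq> Rej" and len: "length Ts = n"
    and na: "next_ctl acc q (tops_of_cells (map read_tape Ts)) = (q', act)"
  shows "step \<M> (e q, Ts) = (e q', map (\<lambda>i. act_tape (act i (read_tape (Ts ! i))) (Ts ! i)) [0..<n])"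
proof -
  have inj: "inj_on e (ctls c0)" using e by (simp add: bij_betw_def)
  have "Acc \<in> ctls c0" "Rej \<in> ctls c0" by (auto simp: ctls_def Let_def)
  then have "\<not> halted \<M> (e q, Ts)"
    using q inj by (auto simp: halted_def machine_def inj_on_def)
  moreover have "inv_into (ctls c0) e (e q) = q" using inj q by simp
  ultimately show ?thesis
    using na len unfolding step_def
    by (auto simp: machine_def intro!: nth_equalityI)
qed

lemma step_keep:
  assumes "q \<in> ctls c0" "q \<noteq> Acc" "q \<noteq> Rej" and h: "tapes_hold n Ts s"
    and "next_ctl acc q (tops s) = (q', keep)"
  shows "step \<M> (e q, Ts) = (e q', Ts)"
proof -
  have len: "length Ts = n" using h by (simp add: tapes_hold_def)
  have "act_tape (keep i (read_tape (Ts ! i))) (Ts ! i) = Ts ! i" for i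
    by (cases "Ts ! i") (simp add: keep_def)
  then show ?thesis
    using step_machine[OF assms(1-3) len, of q' keep] assms(5) tops_read[OF h] len
    by (auto intro!: nth_equalityI)
qed

text \<open>Each rule of \<open>exec\<close> charges exactly the machine steps it causes, so
  induction on the derivation works with \<open>K\<close> and the tapes arbitrary. Membership in
  \<open>conts c0 []\<close> is carried along because \<open>e\<close> can be decoded only on
  \<open>ctls c0\<close>.\<close>

lemma exec_simulated:
  assumes "exec c s t s'"
  shows "c # K \<in> insert [] (conts c0 []) \<Longrightarrow> regs c \<subseteq> {..<n} \<Longrightarrow> tapes_hold n Ts s \<Longrightarrow>
    \<exists>Ts'. (step \<M> ^^ t) (e (Run (c # K)), Ts) = (e (Run K), Ts') \<and> tapes_hold n Ts' s'"
  using assms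
proof (induction arbitrary: K Ts rule: exec.induct)
  case (Skip s)
  then show ?case using step_keep[of "Run (Skip # K)"] by (auto simp: Run_in_ctls)
next
  case (Push i f s)
  have len: "length Ts = n" using Push by (simp add: tapes_hold_def)
  have i: "i < n" using Push by simp
  define L where "L = (\<lambda>x::'a cell. (x, MoveLeft))"
  define Ts1 where "Ts1 = map (\<lambda>j. act_tape ((keep(i := L)) j (read_tape (Ts ! j))) (Ts ! j)) [0..<n]"
  define a where "a = f (tops s)"
  have s1: "step \<M> (e (Run (Push i f # K)), Ts) = (e (Put i a K), Ts1)"
    unfolding Ts1_def
    by (rule step_machine)
      (use Push len tops_read[OF Push.prems(3)] in \<open>auto simp: Run_in_ctls L_def a_def\<close>)
  have len1: "length Ts1 = n" by (simp add: Ts1_def)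
  have put: "Put i a K \<in> ctls c0"
    using Push.prems(1) by (force simp: ctls_def Let_def put_ctls_def)
  define Ts2 where "Ts2 = map (\<lambda>j. act_tape ((keep(i := \<lambda>_. (Inp a, Stay))) j (read_tape (Ts1 ! j))) (Ts1 ! j)) [0..<n]"
  have s2: "step \<M> (e (Put i a K), Ts1) = (e (Run K), Ts2)"
    unfolding Ts2_def by (rule step_machine) (use put len1 in auto)
  have "tape_holds (Ts2 ! j) ((s(i := a # s i)) j)" if j: "j < n" for j
  proof -
    have h: "tape_holds (Ts ! j) (s j)" using Push j by (simp add: tapes_hold_def)
    obtain tp hd where T: "Ts ! j = (tp, hd)" by fastforce
    show ?thesis
    proof (cases "j = i")
      case True
      have T1: "Ts1 ! i = (tp, hd - 1)"
        using T True i by (simp add: Ts1_def L_def)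
      have T2: "Ts2 ! i = (tp(hd - 1 := Inp a), hd - 1)"
        using T1 i by (simp add: Ts2_def)
      \<comment> \<open>The cell left of the old head may hold garbage from an earlier pop; it is
        overwritten, and index \<open>Suc k\<close> is the old index \<open>k\<close>.\<close>
      have "(tp(hd - 1 := Inp a)) (hd - 1 + int m) = (if m < length (a # s i) then Inp ((a # s i) ! m) else Blank)" for m
      proof (cases m)
        case (Suc k)
        then show ?thesis using h T True unfolding tape_holds_def by (auto simp: algebra_simps)
      qed simp
      then show ?thesis using T2 True by (simp add: tape_holds_def)
    next
      case False
      then have "Ts2 ! j = Ts ! j" using j T by (simp add: Ts2_def Ts1_def keep_def)
      then show ?thesis using h False by simp
    qed
  qed
  then have "tapes_hold n Ts2 (s(i := a # s i))"
    using Push i by (auto simp: tapes_hold_def Ts2_def)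
  moreover have "(step \<M> ^^ 2) (e (Run (Push i f # K)), Ts) = (e (Run K), Ts2)"
    using s1 s2 by (simp add: numeral_2_eq_2)
  ultimately show ?case unfolding a_def by blast
next
  case (Pop i s)
  have len: "length Ts = n" using Pop by (simp add: tapes_hold_def)
  have i: "i < n" using Pop by simp
  define R where "R = (\<lambda>x::'a cell. (x, MoveRight))"
  define Ts1 where "Ts1 = map (\<lambda>j. act_tape ((keep(i := R)) j (read_tape (Ts ! j))) (Ts ! j)) [0..<n]"
  have s1: "step \<M> (e (Run (Pop i # K)), Ts) = (e (Run K), Ts1)"
    unfolding Ts1_def
    by (rule step_machine)
      (use Pop len tops_read[OF Pop.prems(3)] in \<open>auto simp: Run_in_ctls R_def\<close>)
  have "tape_holds (Ts1 ! j) ((s(i := tl (s i))) j)" if j: "j < n" for j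
  proof -
    have h: "tape_holds (Ts ! j) (s j)" using Pop j by (simp add: tapes_hold_def)
    obtain tp hd where T: "Ts ! j = (tp, hd)" by fastforce
    show ?thesis
    proof (cases "j = i")
      case True
      have T1: "Ts1 ! i = (tp, hd + 1)"
        using T True i by (simp add: Ts1_def R_def)
      \<comment> \<open>Popping an empty stack is covered too: the head moves from blank to blank,
        and \<open>tl [] = []\<close>.\<close>
      have "tp (hd + 1 + int m) = (if m < length (tl (s i)) then Inp (tl (s i) ! m) else Blank)" for m
      proof -
        have "tp (hd + int (Suc m)) = (if Suc m < length (s i) then Inp (s i ! Suc m) else Blank)"
          using h T True unfolding tape_holds_def by (metis fst_conv snd_conv)
        then show ?thesis by (cases "s i") (auto simp: algebra_simps)
      qed
      then show ?thesis using T1 True by (simp add: tape_holds_def)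
    next
      case False
      then have "Ts1 ! j = Ts ! j" using j T by (simp add: Ts1_def keep_def)
      then show ?thesis using h False by simp
    qed
  qed
  then have "tapes_hold n Ts1 (s(i := tl (s i)))"
    using Pop i by (auto simp: tapes_hold_def Ts1_def)
  moreover have "(step \<M> ^^ 1) (e (Run (Pop i # K)), Ts) = (e (Run K), Ts1)"
    using s1 by simp
  ultimately show ?case by blast
next
  case (Seq c s t s' d u s'')
  have K: "c # d # K \<in> insert [] (conts c0 [])"
    using next_conts_closed[OF Seq.prems(1)] by simp
  have "d # K \<in> insert [] (conts c0 [])" if "c # d # K \<in> insert [] (conts c0 [])"
  proof -
    have "(c ;; d) # K \<in> conts c0 []" using Seq.prems(1) by simp
    then show ?thesis using tail_in_conts that by blast
  qed
  then have K': "d # K \<in> insert [] (conts c0 [])" using K by blast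
  have 1: "step \<M> (e (Run ((c ;; d) # K)), Ts) = (e (Run (c # d # K)), Ts)"
    by (rule step_keep) (use Seq.prems in \<open>auto simp: Run_in_ctls\<close>)
  obtain Ts1 where 2: "(step \<M> ^^ t) (e (Run (c # d # K)), Ts) = (e (Run (d # K)), Ts1)"
      "tapes_hold n Ts1 s'"
    using Seq.IH(1)[OF K _ Seq.prems(3)] Seq.prems(2) by auto
  obtain Ts2 where 3: "(step \<M> ^^ u) (e (Run (d # K)), Ts1) = (e (Run K), Ts2)"
      "tapes_hold n Ts2 s''"
    using Seq.IH(2)[OF K' _ 2(2)] Seq.prems(2) by auto
  show ?case using funpow_chain[OF 1 2(1) 3(1)] 3(2) by blast
next
  case (CondT b s c t s' d)
  have K: "c # K \<in> insert [] (conts c0 [])"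
    using next_conts_closed[OF CondT.prems(1)] by simp
  have 1: "step \<M> (e (Run (Cond b c d # K)), Ts) = (e (Run (c # K)), Ts)"
    by (rule step_keep) (use CondT in \<open>auto simp: Run_in_ctls\<close>)
  obtain Ts1 where 2: "(step \<M> ^^ t) (e (Run (c # K)), Ts) = (e (Run K), Ts1)"
      "tapes_hold n Ts1 s'"
    using CondT.IH[OF K _ CondT.prems(3)] CondT.prems(2) by auto
  show ?case using funpow_chain[OF 1 2(1), of 0] 2(2) by auto
next
  case (CondF b s d t s' c)
  have K: "d # K \<in> insert [] (conts c0 [])"
    using next_conts_closed[OF CondF.prems(1)] by simp
  have 1: "step \<M> (e (Run (Cond b c d # K)), Ts) = (e (Run (d # K)), Ts)"
    by (rule step_keep) (use CondF in \<open>auto simp: Run_in_ctls\<close>)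
  obtain Ts1 where 2: "(step \<M> ^^ t) (e (Run (d # K)), Ts) = (e (Run K), Ts1)"
      "tapes_hold n Ts1 s'"
    using CondF.IH[OF K _ CondF.prems(3)] CondF.prems(2) by auto
  show ?case using funpow_chain[OF 1 2(1), of 0] 2(2) by auto
next
  case (LoopF b s c)
  then show ?case using step_keep[of "Run (Loop b c # K)" Ts s] by (auto simp: Run_in_ctls)
next
  case (LoopT b s c t s' u s'')
  have K: "c # Loop b c # K \<in> insert [] (conts c0 [])"
    using next_conts_closed[OF LoopT.prems(1)] by simp
  have 1: "step \<M> (e (Run (Loop b c # K)), Ts) = (e (Run (c # Loop b c # K)), Ts)"
    by (rule step_keep) (use LoopT in \<open>auto simp: Run_in_ctls\<close>)
  obtain Ts1 where 2: "(step \<M> ^^ t) (e (Run (c # Loop b c # K)), Ts) = (e (Run (Loop b c # K)), Ts1)"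
      "tapes_hold n Ts1 s'"
    using LoopT.IH(1)[OF K _ LoopT.prems(3)] LoopT.prems(2) by auto
  obtain Ts2 where 3: "(step \<M> ^^ u) (e (Run (Loop b c # K)), Ts1) = (e (Run K), Ts2)"
      "tapes_hold n Ts2 s''"
    using LoopT.IH(2)[OF LoopT.prems(1) _ 2(2)] LoopT.prems(2) by auto
  show ?case using funpow_chain[OF 1 2(1) 3(1)] 3(2) by blast
qed

end

lemma decides_machine:
  fixes c :: "'a::finite com"
  assumes e: "bij_betw e (ctls c) {..<card (ctls c)}" and n: "n \<ge> 1"
    and regs: "regs c \<subseteq> {..<n}"
    and run: "\<And>w. \<exists>t s. exec c ((\<lambda>_. [])(0 := w)) t s \<and> t + 1 \<le> T (length w) \<and> (acc (tops s) \<longleftrightarrow> w \<in> L)"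
  shows "decides_in_time (machine n c acc e) L T"
  unfolding decides_in_time_def
proof
  fix w
  let ?M = "machine n c acc e"
  obtain t s where ex: "exec c ((\<lambda>_. [])(0 := w)) t s" and T: "t + 1 \<le> T (length w)"
    and acc: "acc (tops s) \<longleftrightarrow> w \<in> L" using run by blast
  define Ts where "Ts = input_tape w # replicate (n - 1) blank_tape"
  have init: "init_config ?M w = (e (Run [c]), Ts)"
    by (simp add: init_config_def machine_def Ts_def)
  have "tapes_hold n Ts ((\<lambda>_. [])(0 := w))"
    using n unfolding tapes_hold_def Ts_def
    by (auto simp: nth_Cons tape_holds_def input_tape_def blank_tape_def split: nat.splits)
  then obtain Ts' where r: "(step ?M ^^ t) (e (Run [c]), Ts) = (e (Run []), Ts')" "tapes_hold n Ts' s"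
    using exec_simulated[OF e ex, of "[]" n Ts acc] regs Cons_in_conts[of c "[]"] by auto
  \<comment> \<open>One further step evaluates \<open>acc\<close> at the empty continuation and
    halts; this is the \<open>+ 1\<close> in the time bound.\<close>
  have "step ?M (e (Run []), Ts') = (e (if acc (tops s) then Acc else Rej), Ts')"
    by (rule step_keep[OF e _ _ _ r(2)]) (auto simp: Run_in_ctls)
  then have "(step ?M ^^ (t + 1)) (init_config ?M w) = (e (if acc (tops s) then Acc else Rej), Ts')"
    using r init by simp
  then show "\<exists>m\<le>T (length w). fst ((step ?M ^^ m) (init_config ?M w)) =
      (if w \<in> L then accept_state ?M else reject_state ?M)"
    using T acc by (intro exI[of _ "t + 1"]) (auto simp: machine_def)
qed

lemma polynomial_timeI:
  fixes c :: "'a::finite com" and p :: "nat poly"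
  assumes "\<And>w. \<exists>t s. exec c ((\<lambda>_. [])(0 := w)) t s \<and> t + 1 \<le> poly p (length w) \<and> (acc (tops s) \<longleftrightarrow> w \<in> L)"
  shows "L \<in> polynomial_time"
proof -
  obtain e where e: "bij_betw e (ctls c) {..<card (ctls c)}"
    using ex_bij_betw_finite_nat[OF finite_ctls[of c]] by (auto simp: atLeast0LessThan)
  have "finite (regs c)" by (induction c) auto
  then obtain n where n: "regs c \<subseteq> {..<n}" using finite_nat_iff_bounded by blast
  \<comment> \<open>\<open>Suc n\<close> tapes guarantee at least one tape even if the program
    touches no stack.\<close>
  then have "regs c \<subseteq> {..<Suc n}" by (auto simp: less_Suc_eq)
  then show ?thesis
    unfolding polynomial_time_def
    using turing_machine_machine[OF e, of "Suc n" acc] decides_machine[OF e _ _ assms, of "Suc n"]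
    by auto
qed

section \<open>Program rules with upper bounds on the running time\<close>

definition runs :: "'a com \<Rightarrow> 'a stacks \<Rightarrow> nat \<Rightarrow> 'a stacks \<Rightarrow> bool" where
  "runs c s T s' \<longleftrightarrow> (\<exists>t\<le>T. exec c s t s')"

lemma runsI: "exec c s t s' \<Longrightarrow> t \<le> T \<Longrightarrow> runs c s T s'"
  unfolding runs_def by blast

text \<open>The pattern of most verifications below: composed rules produce some final stacks and
  some cost, and what remains is an equation between stacks and an arithmetic inequality.\<close>

lemma runs_eqI: "runs c s T s' \<Longrightarrow> s' = s'' \<Longrightarrow> T \<le> U \<Longrightarrow> runs c s U s''"
  unfolding runs_def using le_trans by blast

lemma runs_Skip: "runs Skip s 1 s"
  by (rule runsI[OF exec.Skip]) simp

lemma runs_Push: "runs (Push i f) s 2 (s(i := f (tops s) # s i))"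
  by (rule runsI[OF exec.Push]) simp

lemma runs_Pop: "runs (Pop i) s 1 (s(i := tl (s i)))"
  by (rule runsI[OF exec.Pop]) simp

lemma runs_Seq: "runs c s T s' \<Longrightarrow> runs d s' U s'' \<Longrightarrow> runs (c ;; d) s (T + U + 1) s''"
proof -
  assume "runs c s T s'" "runs d s' U s''"
  then obtain t u where "exec c s t s'" "t \<le> T" "exec d s' u s''" "u \<le> U" unfolding runs_def by blast
  then show ?thesis using runsI[OF exec.Seq, of c s t s' d u s''] by simp
qed

lemma runs_CondT: "b (tops s) \<Longrightarrow> runs c s T s' \<Longrightarrow> runs (Cond b c d) s (T + 1) s'"
  unfolding runs_def using exec.CondT[of b s c _ s' d] by fastforce

lemma runs_CondF: "\<not> b (tops s) \<Longrightarrow> runs d s T s' \<Longrightarrow> runs (Cond b c d) s (T + 1) s'"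
  unfolding runs_def using exec.CondF[of b s d _ s' c] by fastforce

lemma runs_LoopF: "\<not> b (tops s) \<Longrightarrow> runs (Loop b c) s 1 s"
  unfolding runs_def using exec.LoopF[of b s c] by fastforce

lemma runs_LoopT: "b (tops s) \<Longrightarrow> runs c s T s' \<Longrightarrow> runs (Loop b c) s' U s'' \<Longrightarrow>
    runs (Loop b c) s (T + U + 1) s''"
proof -
  assume b: "b (tops s)" and "runs c s T s'" "runs (Loop b c) s' U s''"
  then obtain t u where "exec c s t s'" "t \<le> T" "exec (Loop b c) s' u s''" "u \<le> U"
    unfolding runs_def by blast
  then show ?thesis using runsI[OF exec.LoopT, of b s c t s' u s''] b by simp
qed

text \<open>Lets a loop be replaced by a \<open>fold\<close>: \<open>xs\<close> is the unread input,
  \<open>a\<close> the accumulated result and \<open>S\<close> their representation on the stacks.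
  \<open>Inv\<close> bounds the data so that a single \<open>T\<close> covers every iteration; the
  guard adds 1 per iteration and 1 for the exit.\<close>

lemma runs_Loop_fold:
  assumes step: "\<And>a y ys. Inv a (y # ys) \<Longrightarrow>
      b (tops (S a (y # ys))) \<and> runs c (S a (y # ys)) T (S (f y a) ys) \<and> Inv (f y a) ys"
    and stop: "\<And>a. Inv a [] \<Longrightarrow> \<not> b (tops (S a []))"
    and init: "Inv a xs"
  shows "runs (Loop b c) (S a xs) ((T + 1) * length xs + 1) (S (fold f xs a) []) \<and>
    Inv (fold f xs a) []"
  using init
proof (induction xs arbitrary: a)
  case Nil
  then show ?case using runs_LoopF[of b "S a []" c] stop by simp
next
  case (Cons y ys)
  note st = step[OF Cons.prems]
  then have IH: "runs (Loop b c) (S (f y a) ys) ((T + 1) * length ys + 1) (S (fold f (y # ys) a) [])"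
    "Inv (fold f (y # ys) a) []"
    using Cons.IH[of "f y a"] by auto
  have "runs (Loop b c) (S a (y # ys)) (T + ((T + 1) * length ys + 1) + 1) (S (fold f (y # ys) a) [])"
    using runs_LoopT[OF conjunct1[OF st] conjunct1[OF conjunct2[OF st]] IH(1)] .
  then show ?case using IH(2) by (auto elim: runs_eqI)
qed

lemma tops_None: "tops s i = None \<longleftrightarrow> s i = []"
  by (auto simp: tops_def split: list.splits)

lemma tops_Cons: "s i = x # xs \<Longrightarrow> tops s i = Some x"
  by (simp add: tops_def)

lemma tops_Nil: "s i = [] \<Longrightarrow> tops s i = None"
  by (simp add: tops_def)

section \<open>Basic stack operations\<close>

definition xfer :: "nat \<Rightarrow> nat \<Rightarrow> 'a com" where
  "xfer a b = Push b (\<lambda>tp. the (tp a)) ;; Pop a"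

definition move_while :: "('a \<Rightarrow> bool) \<Rightarrow> nat \<Rightarrow> nat \<Rightarrow> 'a com" where
  "move_while p a b = Loop (\<lambda>tp. \<exists>x. tp a = Some x \<and> p x) (xfer a b)"

definition move :: "nat \<Rightarrow> nat \<Rightarrow> 'a com" where
  "move = move_while (\<lambda>_. True)"

text \<open>Copying consumes the source, so two targets are filled. Both copies come out reversed,
  and callers compensate by first moving the data to a scratch stack.\<close>

definition dup :: "nat \<Rightarrow> nat \<Rightarrow> nat \<Rightarrow> 'a com" where
  "dup a b c = Loop (\<lambda>tp. tp a \<noteq> None) (Push b (\<lambda>tp. the (tp a)) ;; xfer a c)"

definition clear :: "nat \<Rightarrow> 'a com" where
  "clear a = Loop (\<lambda>tp. tp a \<noteq> None) (Pop a)"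

lemma runs_xfer:
  assumes "a \<noteq> b" "s a = x # xs"
  shows "runs (xfer a b) s 4 (s(a := xs, b := x # s b))"
  unfolding xfer_def
  by (rule runs_eqI[OF runs_Seq[OF runs_Push runs_Pop]])
    (use assms in \<open>auto simp: fun_eq_iff tops_Cons\<close>)

text \<open>A symbol costs 4 for \<open>xfer\<close> (2 for the push, 1 for the pop, 1 for
  sequencing) and 1 for the guard; the last 1 is the failing guard.\<close>

lemma runs_move_while:
  assumes "a \<noteq> b" "s a = xs @ ys" "\<forall>x\<in>set xs. p x" "ys = [] \<or> \<not> p (hd ys)"
  shows "runs (move_while p a b) s (5 * length xs + 1) (s(a := ys, b := rev xs @ s b))"
  using assms
proof (induction xs arbitrary: s)
  case Nil
  then have "\<not> (\<exists>x. tops s a = Some x \<and> p x)" by (cases ys) (simp_all add: tops_def)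
  then show ?case
    unfolding move_while_def
    by (intro runs_eqI[OF runs_LoopF]) (use Nil in \<open>simp_all add: fun_eq_iff\<close>)
next
  case (Cons x xs)
  let ?s = "s(a := xs @ ys, b := x # s b)"
  have IH: "runs (move_while p a b) ?s (5 * length xs + 1) (?s(a := ys, b := rev xs @ ?s b))"
    by (rule Cons.IH) (use Cons.prems in simp_all)
  have 1: "runs (xfer a b) s 4 ?s" by (rule runs_xfer) (use Cons.prems in simp_all)
  show ?case
    unfolding move_while_def
    by (rule runs_eqI[OF runs_LoopT[OF _ 1 IH[unfolded move_while_def]]])
      (use Cons.prems in \<open>simp_all add: tops_Cons fun_eq_iff\<close>)
qed

lemma runs_move:
  assumes "a \<noteq> b"
  shows "runs (move a b) s (5 * length (s a) + 1) (s(a := [], b := rev (s a) @ s b))"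
  unfolding move_def using runs_move_while[of a b s "s a" "[]"] assms by simp

lemma runs_dup:
  assumes "a \<noteq> b" "a \<noteq> c" "b \<noteq> c"
  shows "runs (dup a b c) s (8 * length (s a) + 1)
    (s(a := [], b := rev (s a) @ s b, c := rev (s a) @ s c))"
proof (induction "s a" arbitrary: s)
  case Nil
  show ?case
    unfolding dup_def
    by (rule runs_eqI[OF runs_LoopF]) (use Nil assms in \<open>auto simp: fun_eq_iff tops_Nil\<close>)
next
  case (Cons x xs)
  let ?s = "s(a := xs, b := x # s b, c := x # s c)"
  have 1: "runs (Push b (\<lambda>tp. the (tp a)) ;; xfer a c) s (2 + 4 + 1) ?s"
    by (rule runs_eqI[OF runs_Seq[OF runs_Push runs_xfer]])
      (use assms Cons(2)[symmetric] in \<open>auto simp: fun_eq_iff tops_Cons\<close>)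
  have 2: "runs (dup a b c) ?s (8 * length (?s a) + 1)
     (?s(a := [], b := rev (?s a) @ ?s b, c := rev (?s a) @ ?s c))"
    using assms by (intro Cons(1)) auto
  have 3: "tops s a \<noteq> None" using Cons(2)[symmetric] by (simp add: tops_Cons)
  show ?case
    unfolding dup_def
    by (rule runs_eqI[OF runs_LoopT[OF 3 1 2[unfolded dup_def]]])
      (use assms Cons(2)[symmetric] in \<open>auto simp: fun_eq_iff\<close>)
qed

lemma runs_clear: "runs (clear a) s (2 * length (s a) + 1) (s(a := []))"
proof (induction "s a" arbitrary: s)
  case Nil
  show ?case
    unfolding clear_def
    by (rule runs_eqI[OF runs_LoopF]) (use Nil in \<open>auto simp: fun_eq_iff tops_Nil\<close>)
next
  case (Cons x xs)
  let ?s = "s(a := tl (s a))"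
  have 2: "runs (clear a) ?s (2 * length (?s a) + 1) (?s(a := []))"
    using Cons(2)[symmetric] by (intro Cons(1)) auto
  have 3: "tops s a \<noteq> None" using Cons(2)[symmetric] by (simp add: tops_Cons)
  show ?case
    unfolding clear_def
    by (rule runs_eqI[OF runs_LoopT[OF 3 runs_Pop 2[unfolded clear_def]]])
      (use Cons(2)[symmetric] in \<open>auto simp: fun_eq_iff\<close>)
qed

section \<open>Backbones of definite Horn formulas\<close>

text \<open>Clauses are read as rules from body to head. For definite Horn formulas this says that
  the characteristic function of \<open>A\<close> is a model.\<close>

definition Horn_closed :: "'v formula \<Rightarrow> 'v set \<Rightarrow> bool" where
  "Horn_closed \<phi> A \<longleftrightarrow> (\<forall>C\<in>\<phi>. \<forall>v. Pos v \<in> C \<longrightarrow> {u. Neg u \<in> C} \<subseteq> A \<longrightarrow> v \<in> A)"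

lemma satisfies_True:
  assumes "\<And>C. C \<in> \<phi> \<Longrightarrow> \<exists>v. Pos v \<in> C"
  shows "satisfies (\<lambda>_. True) \<phi>"
  unfolding satisfies_def
proof
  fix C assume "C \<in> \<phi>"
  then obtain v where "Pos v \<in> C" using assms by blast
  then show "\<exists>l\<in>C. sat_lit (\<lambda>_. True) l" by (intro bexI[of _ "Pos v"]) simp_all
qed

lemma entails_Pos: "entails \<phi> {{Pos x}} \<longleftrightarrow> (\<forall>\<tau>. satisfies \<tau> \<phi> \<longrightarrow> \<tau> x)"
  by (simp add: entails_def satisfies_def)

lemma entails_PosI:
  assumes "\<And>\<tau>. satisfies \<tau> \<phi> \<Longrightarrow> \<tau> x" shows "entails \<phi> {{Pos x}}"
  unfolding entails_Pos by (intro allI impI) (rule assms)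

lemma entails_PosD: "entails \<phi> {{Pos x}} \<Longrightarrow> satisfies \<tau> \<phi> \<Longrightarrow> \<tau> x"
  unfolding entails_Pos by (drule spec[where x = \<tau>], drule mp)

lemma entails_Neg: "entails \<phi> {{Neg x}} \<longleftrightarrow> (\<forall>\<tau>. satisfies \<tau> \<phi> \<longrightarrow> \<not> \<tau> x)"
  by (simp add: entails_def satisfies_def)

lemma satisfies_reduct_Pos:
  assumes "\<tau> y" "satisfies \<tau> \<phi>"
  shows "satisfies \<tau> (reduct \<phi> (Pos y))"
  unfolding satisfies_def reduct_def
proof safe
  fix C assume "C \<in> \<phi>" "Pos y \<notin> C"
  then obtain l where "l \<in> C" "sat_lit \<tau> l" using assms(2) by (auto simp: satisfies_def)
  moreover have "l \<noteq> Neg y" using \<open>sat_lit \<tau> l\<close> assms(1) by auto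
  ultimately show "\<exists>l\<in>C - {compl (Pos y)}. sat_lit \<tau> l" by auto
qed

lemma reduct_Pos_has_pos:
  assumes "\<And>C. C \<in> \<phi> \<Longrightarrow> \<exists>v. Pos v \<in> C" and "D \<in> reduct \<phi> (Pos y)"
  shows "\<exists>v. Pos v \<in> D"
proof -
  obtain C where C: "C \<in> \<phi>" "D = C - {Neg y}" using assms(2) by (auto simp: reduct_def)
  then obtain v where "Pos v \<in> C" using assms(1) by blast
  then show ?thesis using C(2) by blast
qed

text \<open>The all-true assignment is a model, so only positive literals are entailed; and every
  literal along which the formula is reduced is itself entailed.\<close>

lemma iterative_backbone_entails:
  assumes "iterative_k_backbone k \<phi> x" and "\<And>C. C \<in> \<phi> \<Longrightarrow> \<exists>v. Pos v \<in> C"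
  shows "entails \<phi> {{Pos x}}"
  using assms
proof (induction rule: iterative_k_backbone.induct)
  case (base \<phi> x)
  then obtain \<psi> where "\<psi> \<subseteq> \<phi>" and e: "entails \<psi> {{Pos x}} \<or> entails \<psi> {{Neg x}}"
    unfolding k_backbone_def by blast
  then have "satisfies (\<lambda>_. True) \<psi>" using base.prems by (intro satisfies_True) blast
  then have "entails \<psi> {{Pos x}}" using e by (auto simp: entails_Neg)
  moreover have "satisfies \<tau> \<psi>" if "satisfies \<tau> \<phi>" for \<tau>
    using that \<open>\<psi> \<subseteq> \<phi>\<close> by (auto simp: satisfies_def)
  ultimately have "\<tau> x" if "satisfies \<tau> \<phi>" for \<tau>
    using that entails_PosD[of \<psi> x \<tau>] by simp
  then show ?case by (rule entails_PosI)
next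
  case (step y \<phi> l x)
  have "satisfies (\<lambda>_. True) \<phi>" using step.prems by (rule satisfies_True)
  then have l: "l = Pos y" using step.hyps(3,4) by (auto simp: entails_Neg)
  have "entails (reduct \<phi> l) {{Pos x}}"
    using step.IH reduct_Pos_has_pos[OF step.prems] l by blast
  then have "\<tau> x" if "satisfies \<tau> \<phi>" for \<tau>
    using that step.hyps(4) satisfies_reduct_Pos[of \<tau> y \<phi>] l
      entails_PosD[of \<phi> y \<tau>] entails_PosD[of "reduct \<phi> l" x \<tau>] by simp
  then show ?case by (rule entails_PosI)
qed

lemma entails_iterative_backbone:
  assumes "k \<ge> 1" "finite \<phi>" "\<And>C. C \<in> \<phi> \<Longrightarrow> \<exists>!v. Pos v \<in> C" "entails \<phi> {{Pos x}}"
  shows "iterative_k_backbone k \<phi> x"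
  using assms(2-)
proof (induction "card \<phi>" arbitrary: \<phi> rule: less_induct)
  case less
  have "\<not> satisfies (\<lambda>_. False) \<phi>" using less.prems(3) by (auto simp: entails_Pos)
  then obtain C where C: "C \<in> \<phi>" "\<forall>l\<in>C. \<not> sat_lit (\<lambda>_. False) l"
    unfolding satisfies_def by blast
  obtain y where y: "Pos y \<in> C" using less.prems(2)[OF C(1)] by blast
  \<comment> \<open>A literal that is false under the all-false assignment is positive, and
    \<open>C\<close> has only one of these.\<close>
  have "l = Pos y" if "l \<in> C" for l
    using that C y less.prems(2)[OF C(1)] by (cases l) auto
  then have Cy: "C = {Pos y}" using y by blast
  have ent: "entails \<phi> {{Pos y}}"
    using C(1) unfolding Cy entails_def satisfies_def by blast
  have kb: "k_backbone k \<phi> y"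
    unfolding k_backbone_def using C(1) assms(1) Cy
    by (intro exI[of _ "{C}"]) (auto simp: entails_def)
  show ?case
  proof (cases "x = y")
    case True
    then show ?thesis using kb by (simp add: iterative_k_backbone.base)
  next
    case False
    let ?\<psi> = "reduct \<phi> (Pos y)"
    \<comment> \<open>Only an inequality, since clauses may coincide once \<open>Neg y\<close> is
      removed. The strict decrease comes from the unit clause, which the reduct deletes.\<close>
    have "card ?\<psi> \<le> card {C \<in> \<phi>. Pos y \<notin> C}"
      unfolding reduct_def using less.prems(1) by (intro card_image_le) simp
    also have "\<dots> < card \<phi>" using C(1) y less.prems(1) by (intro psubset_card_mono) auto
    finally have card: "card ?\<psi> < card \<phi>" .
    have fin: "finite ?\<psi>" using less.prems(1) by (simp add: reduct_def)
    have horn: "\<exists>!v. Pos v \<in> D" if D: "D \<in> ?\<psi>" for D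
    proof -
      obtain C where "D = C - {Neg y}" "C \<in> \<phi>" using D by (auto simp: reduct_def)
      then show ?thesis using less.prems(2)[of C] by simp
    qed
    have "entails ?\<psi> {{Pos x}}"
    proof (rule entails_PosI)
      fix \<tau> assume \<tau>: "satisfies \<tau> ?\<psi>"
      \<comment> \<open>Making \<open>y\<close> true satisfies the deleted clauses, and a surviving
        clause has a true literal that does not mention \<open>y\<close>. As \<open>x\<close>
        differs from \<open>y\<close>, its value is unchanged.\<close>
      have "satisfies (\<tau>(y := True)) \<phi>"
        unfolding satisfies_def
      proof
        fix C assume "C \<in> \<phi>"
        show "\<exists>l\<in>C. sat_lit (\<tau>(y := True)) l"
        proof (cases "Pos y \<in> C")
          case True then show ?thesis by (intro bexI[of _ "Pos y"]) auto
        next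
          case False
          then have "C - {Neg y} \<in> ?\<psi>" using \<open>C \<in> \<phi>\<close> by (auto simp: reduct_def)
          then have "\<exists>l\<in>C - {Neg y}. sat_lit \<tau> l" using \<tau> unfolding satisfies_def by (rule bspec[rotated])
          then obtain l where l: "l \<in> C" "l \<noteq> Neg y" "sat_lit \<tau> l" by blast
          then have "sat_lit (\<tau>(y := True)) l" using False by (cases l) auto
          then show ?thesis using l by blast
        qed
      qed
      from entails_PosD[of \<phi> x "\<tau>(y := True)", OF less.prems(3) this]
      show "\<tau> x" using False by simp
    qed
    with less.hyps[OF card fin horn] have "iterative_k_backbone k ?\<psi> x" by simp
    moreover have "y \<in> Vars \<phi>" using C(1) y unfolding Vars_def by force
    ultimately show ?thesis
      using iterative_k_backbone.step[of y \<phi> k "Pos y" x] kb ent by simp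
  qed
qed

lemma iterative_backbone_iff_entails:
  assumes "\<phi> \<in> definite_Horn" "k \<ge> 1"
  shows "iterative_k_backbone k \<phi> x \<longleftrightarrow> entails \<phi> {{Pos x}}"
proof -
  have u: "\<exists>!v. Pos v \<in> C" if "C \<in> \<phi>" for C
    using assms(1) that by (simp add: definite_Horn_def is_cnf_def)
  have fin: "finite \<phi>" using assms(1) by (simp add: definite_Horn_def is_cnf_def)
  show ?thesis
    using iterative_backbone_entails[of k \<phi> x, OF _ ex1_implies_ex[OF u]]
      entails_iterative_backbone[OF assms(2) fin u] by blast
qed

lemma entails_closed:
  assumes "\<And>C. C \<in> \<phi> \<Longrightarrow> \<exists>v. Pos v \<in> C" "Horn_closed \<phi> A" "entails \<phi> {{Pos x}}"
  shows "x \<in> A"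
proof -
  have "satisfies (\<lambda>v. v \<in> A) \<phi>"
    unfolding satisfies_def
  proof
    fix C assume C: "C \<in> \<phi>"
    obtain v where v: "Pos v \<in> C" using assms(1)[OF C] by blast
    show "\<exists>l\<in>C. sat_lit (\<lambda>v. v \<in> A) l"
    proof (cases "{u. Neg u \<in> C} \<subseteq> A")
      case True
      then have "v \<in> A" using assms(2) C v unfolding Horn_closed_def by blast
      then show ?thesis using v by force
    next
      case False then show ?thesis by force
    qed
  qed
  from entails_PosD[of \<phi> x "\<lambda>v. v \<in> A", OF assms(3) this] show ?thesis .
qed

text \<open>Each strict step gains an element, so the \<open>i\<close>-th iterate has at least
  \<open>i\<close> elements unless the iteration has already stopped; after \<open>n\<close> steps
  it has stopped or exhausted \<open>H\<close>.\<close>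

lemma funpow_stationary:
  fixes F :: "'a set \<Rightarrow> 'a set"
  assumes mono: "\<And>A. A \<subseteq> F A"
    and H: "finite H" "card H \<le> n" "\<And>i. (F ^^ i) A \<subseteq> H"
  shows "F ((F ^^ n) A) = (F ^^ n) A"
proof -
  have "i \<le> card ((F ^^ i) A) \<or> F ((F ^^ i) A) = (F ^^ i) A" for i
  proof (induction i)
    case (Suc i)
    show ?case
    proof (cases "F ((F ^^ i) A) = (F ^^ i) A")
      case True
      then show ?thesis by simp
    next
      case False
      have "finite ((F ^^ Suc i) A)" using H(1,3) finite_subset by blast
      then have "card ((F ^^ i) A) < card ((F ^^ Suc i) A)"
        using False mono[of "(F ^^ i) A"] by (intro psubset_card_mono) auto
      then show ?thesis using Suc False by simp
    qed
  qed simp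
  from this[of n] show ?thesis
  proof
    assume "n \<le> card ((F ^^ n) A)"
    then have "(F ^^ n) A = H" using H card_seteq le_trans by metis
    then show ?thesis using mono[of "(F ^^ n) A"] H(3)[of "Suc n"] by auto
  qed
qed

section \<open>Looking up variables\<close>

text \<open>Truth is nonemptiness, so a guard can test it, and raising never stores a second symbol,
  so clearing takes constant time.\<close>

definition flag :: "bool \<Rightarrow> sym list" where
  "flag b = (if b then [Bit1] else [])"

definition raise_flag :: "nat \<Rightarrow> sym com" where
  "raise_flag i = Cond (\<lambda>tp. tp i = None) (Push i (\<lambda>_. Bit1)) Skip"

lemma runs_raise_flag:
  assumes "s i = flag b"
  shows "runs (raise_flag i) s 3 (s(i := flag True))"
proof (cases b)
  case True
  then show ?thesis
    unfolding raise_flag_def using assms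
    by (intro runs_eqI[OF runs_CondF[OF _ runs_Skip]]) (auto simp: flag_def tops_Cons fun_eq_iff)
next
  case False
  then show ?thesis
    unfolding raise_flag_def using assms
    by (intro runs_eqI[OF runs_CondT[OF _ runs_Push]]) (auto simp: flag_def tops_Nil fun_eq_iff)
qed

definition raise_if :: "((nat \<Rightarrow> sym option) \<Rightarrow> bool) \<Rightarrow> nat \<Rightarrow> sym com" where
  "raise_if g i = Cond g (raise_flag i) Skip"

lemma runs_raise_if:
  assumes "s i = flag b"
  shows "runs (raise_if g i) s 4 (s(i := flag (b \<or> g (tops s))))"
proof (cases "g (tops s)")
  case True
  then show ?thesis
    unfolding raise_if_def using assms
    by (intro runs_eqI[OF runs_CondT[of g, OF _ runs_raise_flag]]) auto
next
  case False
  then show ?thesis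
    unfolding raise_if_def using assms
    by (intro runs_eqI[OF runs_CondF[of g, OF _ runs_Skip]]) (auto simp: fun_eq_iff)
qed

lemma length_flag: "length (flag b) \<le> 1"
  by (simp add: flag_def)

definition is_bit :: "sym \<Rightarrow> bool" where
  "is_bit a \<longleftrightarrow> a = Bit0 \<or> a = Bit1"

text \<open>The input starts on \<open>rI\<close>; \<open>rQ\<close> holds its parsed part reversed, \<open>rS\<close> the states of the
  parser and then the round counter, \<open>rW\<close> a copy of the input; \<open>rP\<close> and \<open>rN\<close> hold the positive and
  negative literals of the current clause, \<open>rT\<close> the derived variables, \<open>rV\<close> the variable being looked
  up; \<open>rB\<close>, \<open>rU\<close>, \<open>rX\<close> are scratch. Flags: \<open>rM\<close> (match) and \<open>rD\<close> (difference) of a lookup,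
  \<open>rE\<close> (not definite Horn), \<open>rF\<close> (\<open>x\<close> derived), \<open>rG\<close> (clause not ready to fire).\<close>

abbreviation (input) "rI \<equiv> (0::nat)"
abbreviation (input) "rQ \<equiv> (1::nat)"
abbreviation (input) "rS \<equiv> (2::nat)"
abbreviation (input) "rW \<equiv> (3::nat)"
abbreviation (input) "rP \<equiv> (4::nat)"
abbreviation (input) "rN \<equiv> (5::nat)"
abbreviation (input) "rT \<equiv> (6::nat)"
abbreviation (input) "rV \<equiv> (7::nat)"
abbreviation (input) "rB \<equiv> (8::nat)"
abbreviation (input) "rU \<equiv> (9::nat)"
abbreviation (input) "rM \<equiv> (10::nat)"
abbreviation (input) "rD \<equiv> (11::nat)"
abbreviation (input) "rE \<equiv> (12::nat)"
abbreviation (input) "rF \<equiv> (13::nat)"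
abbreviation (input) "rG \<equiv> (14::nat)"
abbreviation (input) "rX \<equiv> (15::nat)"

definition lockstep :: "nat \<Rightarrow> sym com" where
  "lockstep X = Loop (\<lambda>tp. \<exists>x. tp X = Some x \<and> is_bit x \<and> tp rV = Some x) (xfer X rU ;; xfer rV rB)"

text \<open>Comparing consumes both strings. The symbols of \<open>rV\<close> wait on
  \<open>rB\<close> and are restored at once for the next token; those of \<open>X\<close> collect
  on \<open>rU\<close> until \<open>scan\<close> moves them all back.\<close>

definition compare_token :: "nat \<Rightarrow> sym com" where
  "compare_token X =
     lockstep X ;;
     Cond (\<lambda>tp. tp rV = None \<and> \<not> (\<exists>x. tp X = Some x \<and> is_bit x)) (raise_flag rM) (raise_flag rD) ;;
     move_while is_bit X rU ;; xfer X rU ;; move rB rV"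

definition scan :: "nat \<Rightarrow> sym com" where
  "scan X = Loop (\<lambda>tp. tp X \<noteq> None) (compare_token X) ;; move rU X"

fun lcp :: "'a list \<Rightarrow> 'a list \<Rightarrow> nat" where
  "lcp (x # xs) (y # ys) = (if x = y then Suc (lcp xs ys) else 0)"
| "lcp _ _ = 0"

lemma lcp_le: "lcp xs ys \<le> length xs" "lcp xs ys \<le> length ys"
  by (induction xs ys rule: lcp.induct) auto

text \<open>Stated in the form of the test after \<open>lockstep\<close>: nothing is left of either
  string.\<close>

lemma lcp_full_iff: "length xs \<le> lcp xs ys \<and> length ys \<le> lcp xs ys \<longleftrightarrow> xs = ys"
  by (induction xs ys rule: lcp.induct) auto

lemma runs_lockstep:
  assumes "X \<notin> {rV, rB, rU}" "s X = xs @ a # r" "s rV = vs" "\<forall>x\<in>set xs. is_bit x" "\<not> is_bit a"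
    and "k = lcp xs vs"
  shows "runs (lockstep X) s (10 * k + 1)
      (s(X := drop k xs @ a # r, rV := drop k vs,
         rU := rev (take k xs) @ s rU, rB := rev (take k vs) @ s rB))"
  using assms
proof (induction xs vs arbitrary: s k rule: lcp.induct)
  case (1 x xs y vs)
  show ?case
  proof (cases "x = y")
    case True
    define j where "j = lcp xs vs"
    let ?s = "s(X := xs @ a # r, rV := vs, rU := x # s rU, rB := x # s rB)"
    have IH: "runs (lockstep X) ?s (10 * j + 1)
        (?s(X := drop j xs @ a # r, rV := drop j vs,
            rU := rev (take j xs) @ ?s rU, rB := rev (take j vs) @ ?s rB))"
      by (rule "1.IH"[OF True]) (use "1.prems" j_def in simp_all)
    have 1: "runs (xfer X rU ;; xfer rV rB) s (4 + 4 + 1) ?s"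
      by (rule runs_eqI[OF runs_Seq[OF runs_xfer[where x = x and xs = "xs @ a # r"] runs_xfer[where x = x and xs = vs]]])
        (use "1.prems" True in \<open>simp_all add: fun_eq_iff\<close>)
    have k: "k = Suc j" using "1.prems"(6) True by (simp add: j_def)
    show ?thesis
      unfolding lockstep_def
      by (rule runs_eqI[OF runs_LoopT[OF _ 1 IH[unfolded lockstep_def]]])
        (use "1.prems"(1-5) True k in \<open>simp_all add: fun_eq_iff tops_Cons\<close>)
  next
    case False
    show ?thesis
      unfolding lockstep_def
      by (rule runs_eqI[OF runs_LoopF]) (use "1.prems" False in \<open>simp_all add: fun_eq_iff tops_Cons\<close>)
  qed
next
  case ("2_1" vs)
  then show ?case
    unfolding lockstep_def
    by (intro runs_eqI[OF runs_LoopF]) (simp_all add: fun_eq_iff tops_Cons)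
next
  case ("2_2" xs)
  then show ?case
    unfolding lockstep_def
    by (intro runs_eqI[OF runs_LoopF]) (simp_all add: fun_eq_iff tops_Nil)
qed

lemma runs_compare_token:
  assumes X: "X \<notin> {rV, rB, rU, rM, rD}" and sX: "s X = xs @ a # r" and sV: "s rV = vs"
    and bits: "\<forall>x\<in>set xs. is_bit x" "\<not> is_bit a"
    and s: "s rB = []" "s rM = flag m" "s rD = flag d"
    and n: "length xs \<le> n" "length vs \<le> n"
  shows "runs (compare_token X) s (20 * (n + 1))
    (s(X := r, rU := a # rev xs @ s rU, rM := flag (m \<or> xs = vs), rD := flag (d \<or> xs \<noteq> vs)))"
proof -
  define k where "k = lcp xs vs"
  let ?s1 = "s(X := drop k xs @ a # r, rV := drop k vs,
         rU := rev (take k xs) @ s rU, rB := rev (take k vs) @ s rB)"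
  have 1: "runs (lockstep X) s (10 * k + 1) ?s1"
    by (rule runs_lockstep) (use X sX sV bits k_def in simp_all)
  let ?g = "\<lambda>tp. tp rV = None \<and> \<not> (\<exists>x. tp X = Some x \<and> is_bit x)"
  \<comment> \<open>The non-bit \<open>a\<close> is a sentinel: the token is used up exactly when
    the top of \<open>X\<close> is not a bit.\<close>
  have g: "?g (tops ?s1) \<longleftrightarrow> xs = vs"
  proof -
    have "tops ?s1 X = Some (hd (drop k xs @ [a]))"
      using X by (cases "drop k xs") (simp_all add: tops_def)
    moreover have "is_bit (hd (drop k xs @ [a])) \<longleftrightarrow> drop k xs \<noteq> []"
      using bits by (cases "drop k xs") (simp_all, metis in_set_dropD list.set_intros(1))
    moreover have "tops ?s1 rV = None \<longleftrightarrow> drop k vs = []" by (simp add: tops_None)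
    ultimately show ?thesis using lcp_full_iff[of xs vs] unfolding k_def by auto
  qed
  let ?s2 = "?s1(rM := flag (m \<or> xs = vs), rD := flag (d \<or> xs \<noteq> vs))"
  have 2: "runs (Cond ?g (raise_flag rM) (raise_flag rD)) ?s1 4 ?s2"
  proof (cases "xs = vs")
    case True
    have "runs (raise_flag rM) ?s1 3 ?s2"
      by (rule runs_eqI[OF runs_raise_flag[of _ rM m]]) (use True X s in \<open>simp_all add: fun_eq_iff\<close>)
    then show ?thesis using runs_CondT[of ?g ?s1 _ 3] g True by simp
  next
    case False
    have "runs (raise_flag rD) ?s1 3 ?s2"
      by (rule runs_eqI[OF runs_raise_flag[of _ rD d]]) (use False X s in \<open>simp_all add: fun_eq_iff\<close>)
    then show ?thesis using runs_CondF[of ?g ?s1 _ 3] g False by simp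
  qed
  let ?s3 = "?s2(X := a # r, rU := rev (drop k xs) @ ?s2 rU)"
  have 3: "runs (move_while is_bit X rU) ?s2 (5 * length (drop k xs) + 1) ?s3"
    by (rule runs_move_while) (use X bits in \<open>simp_all, blast dest: in_set_dropD\<close>)
  let ?s4 = "?s3(X := r, rU := a # ?s3 rU)"
  have 4: "runs (xfer X rU) ?s3 4 ?s4"
    by (rule runs_xfer) (use X in simp_all)
  let ?s5 = "?s4(rB := [], rV := rev (?s4 rB) @ ?s4 rV)"
  have 5: "runs (move rB rV) ?s4 (5 * length (?s4 rB) + 1) ?s5"
    by (rule runs_move) simp
  have len: "k \<le> length xs" "k \<le> length vs" using lcp_le[of xs vs] by (simp_all add: k_def)
  have xs: "rev (drop k xs) @ rev (take k xs) @ u = rev xs @ u" for u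
    by (metis append.assoc append_take_drop_id rev_append)
  show ?thesis
    unfolding compare_token_def
    by (rule runs_eqI[OF runs_Seq[OF 1 runs_Seq[OF 2 runs_Seq[OF 3 runs_Seq[OF 4 5]]]]])
      (use X s len n xs sV in \<open>simp_all add: fun_eq_iff\<close>)
qed

text \<open>Literals end up on a stack by moving symbols one at a time, so they are read off it backwards:
  first the bits in reverse, then the sign.\<close>

definition toks :: "nat lit list \<Rightarrow> sym list" where
  "toks ls = concat (map (\<lambda>l. rev (enc_lit l)) ls)"

primrec sign :: "'v lit \<Rightarrow> sym" where
  "sign (Pos v) = Plus"
| "sign (Neg v) = Minus"

lemma enc_lit_eq: "enc_lit l = sign l # enc_nat (var l)"
  by (cases l) auto

lemma toks_Cons: "toks (l # ls) = rev (enc_nat (var l)) @ sign l # toks ls"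
  by (simp add: toks_def enc_lit_eq)

lemma toks_Nil: "toks [] = []"
  by (simp add: toks_def)

lemma sign_not_bit: "\<not> is_bit (sign l)"
  by (cases l) (auto simp: is_bit_def)

lemma enc_nat_bits: "x \<in> set (enc_nat n) \<Longrightarrow> is_bit x"
proof (induction n rule: enc_nat.induct)
  case (1 n)
  then show ?case using enc_nat.simps[of n] by (auto simp: is_bit_def split: if_splits)
qed

lemma enc_nat_inject: "enc_nat m = enc_nat n \<longleftrightarrow> m = n"
proof (induction m arbitrary: n rule: enc_nat.induct)
  case (1 m)
  show ?case
  proof (cases "m = 0 \<or> n = 0")
    case True
    then show ?thesis using enc_nat.simps[of m] enc_nat.simps[of n] by auto
  next
    case False
    then have "enc_nat m = enc_nat n \<longleftrightarrow> odd m = odd n \<and> enc_nat (m div 2) = enc_nat (n div 2)"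
      using enc_nat.simps[of m] enc_nat.simps[of n] by auto
    also have "\<dots> \<longleftrightarrow> odd m = odd n \<and> m div 2 = n div 2" using 1 False by auto
    also have "\<dots> \<longleftrightarrow> m = n" by presburger
    finally show ?thesis .
  qed
qed

lemma length_toks: "length ls \<le> length (toks ls)"
  by (induction ls) (auto simp: toks_Cons toks_Nil)

text \<open>Every token contains a sign, so there are at most \<open>n\<close> of them, each
  compared within \<open>20 * (n + 1)\<close> steps. Equality of strings becomes equality of
  variables by injectivity of \<open>enc_nat\<close>.\<close>

lemma runs_scan:
  assumes X: "X \<notin> {rV, rB, rU, rM, rD}" and sX: "s X = toks ls" and V: "s rV = rev (enc_nat v)"
    and s: "s rB = []" "s rU = []" "s rM = flag m" "s rD = flag d"
    and n: "length (toks ls) \<le> n" "length (enc_nat v) \<le> n"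
  shows "runs (scan X) s (30 * (n + 1) ^ 2)
    (s(rM := flag (m \<or> v \<in> var ` set ls), rD := flag (d \<or> (\<exists>l\<in>set ls. var l \<noteq> v))))"
proof -
  define S where "S = (\<lambda>(m, d, u) ls. s(X := toks ls, rU := u, rM := flag m, rD := flag d))"
  define f where "f = (\<lambda>l (m, d, u). (m \<or> var l = v, d \<or> var l \<noteq> v, enc_lit l @ u))"
  have step: "tops (S a (l # ls)) X \<noteq> None \<and>
      runs (compare_token X) (S a (l # ls)) (20 * (n + 1)) (S (f l a) ls) \<and> length (toks ls) \<le> n"
    if n': "length (toks (l # ls)) \<le> n" for a l ls
  proof -
    obtain m d u where a: "a = (m, d, u)" by (cases a) auto
    let ?s = "s(X := toks (l # ls), rU := u, rM := flag m, rD := flag d)"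
    have "runs (compare_token X) ?s (20 * (n + 1))
       (?s(X := toks ls, rU := sign l # rev (rev (enc_nat (var l))) @ ?s rU,
           rM := flag (m \<or> rev (enc_nat (var l)) = rev (enc_nat v)),
           rD := flag (d \<or> rev (enc_nat (var l)) \<noteq> rev (enc_nat v))))"
      by (rule runs_compare_token)
        (use X s V n(2) n' in \<open>simp_all add: toks_Cons sign_not_bit enc_nat_bits\<close>)
    then have "runs (compare_token X) ?s (20 * (n + 1)) (S (f l a) ls)"
      by (rule runs_eqI) (use X in \<open>simp_all add: S_def a f_def fun_eq_iff enc_nat_inject enc_lit_eq\<close>)
    moreover have "tops ?s X \<noteq> None" using X by (simp add: toks_Cons tops_None)
    ultimately show ?thesis using n' by (simp add: S_def a toks_Cons)
  qed
  have stop: "\<not> tops (S a []) X \<noteq> None" for a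
    using X by (cases a) (simp add: S_def toks_Nil tops_None)
  have "runs (Loop (\<lambda>tp. tp X \<noteq> None) (compare_token X)) (S (m, d, []) ls)
      ((20 * (n + 1) + 1) * length ls + 1) (S (fold f ls (m, d, [])) [])"
    by (rule conjunct1, rule runs_Loop_fold[where Inv = "\<lambda>_ ls. length (toks ls) \<le> n"])
      (use step stop n(1) in blast)+
  moreover have "fold f ls (m, d, u) =
      (m \<or> v \<in> var ` set ls, d \<or> (\<exists>l\<in>set ls. var l \<noteq> v), rev (toks ls) @ u)" for u
    by (induction ls arbitrary: m d u) (auto simp: f_def toks_Cons toks_Nil enc_lit_eq)
  moreover have "S (m, d, []) ls = s" using X s sX by (simp add: S_def fun_eq_iff)
  ultimately have 1: "runs (Loop (\<lambda>tp. tp X \<noteq> None) (compare_token X)) s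
      ((20 * (n + 1) + 1) * length ls + 1)
      (S (m \<or> v \<in> var ` set ls, d \<or> (\<exists>l\<in>set ls. var l \<noteq> v), rev (toks ls)) [])"
    (is "runs _ _ _ ?s1") by simp
  have 2: "runs (move rU X) ?s1 (5 * length (?s1 rU) + 1) (?s1(rU := [], X := rev (?s1 rU) @ ?s1 X))"
    by (rule runs_move) (use X in simp)
  have U: "?s1 rU = rev (toks ls)" using X by (simp add: S_def)
  have "length ls \<le> n" using length_toks[of ls] n by simp
  then have "(20 * (n + 1) + 1) * length ls \<le> (20 * (n + 1) + 1) * n" by (rule mult_le_mono2)
  then have t: "(20 * (n + 1) + 1) * length ls + 1 + (5 * length (?s1 rU) + 1) + 1 \<le> 30 * (n + 1) ^ 2"
    using n unfolding U by (simp add: power2_eq_square algebra_simps)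
  show ?thesis
    unfolding scan_def
    by (rule runs_eqI[OF runs_Seq[OF 1 2] _ t])
      (use X s sX in \<open>simp add: S_def fun_eq_iff toks_Nil\<close>)
qed

section \<open>Forward chaining on stacks\<close>

primrec is_pos :: "'v lit \<Rightarrow> bool" where
  "is_pos (Pos v) = True"
| "is_pos (Neg v) = False"

text \<open>Reversed because the literal read last ends up on top of the stack.\<close>

definition pos_lits :: "'v lit list \<Rightarrow> 'v lit list" where
  "pos_lits ls = rev (filter is_pos ls)"

definition neg_lits :: "'v lit list \<Rightarrow> 'v lit list" where
  "neg_lits ls = rev (filter (\<lambda>l. \<not> is_pos l) ls)"

definition read_lits :: "sym com" where
  "read_lits = Loop (\<lambda>tp. tp rI \<noteq> Some ClauseEnd)
     (Cond (\<lambda>tp. tp rI = Some Plus)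
       (xfer rI rP ;; move_while is_bit rI rP)
       (xfer rI rN ;; move_while is_bit rI rN))"

lemma toks_append: "toks (ls @ ms) = toks ls @ toks ms"
  by (simp add: toks_def)

text \<open>Ensures that \<open>move_while is_bit\<close> stops exactly at the end of a
  literal.\<close>

lemma after_lits: "hd (concat (map enc_lit ls) @ ClauseEnd # r) \<in> {Plus, Minus, ClauseEnd}"
  by (cases ls; cases "hd ls") auto

lemma runs_read_lits:
  assumes I: "s rI = concat (map enc_lit ls) @ ClauseEnd # r"
    and n: "length (concat (map enc_lit ls)) \<le> n"
  shows "runs read_lits s (8 * (n + 1) ^ 2)
    (s(rI := ClauseEnd # r, rP := toks (pos_lits ls) @ s rP, rN := toks (neg_lits ls) @ s rN))"
proof -
  define S where "S = (\<lambda>(p, q) ls. s(rI := concat (map enc_lit ls) @ ClauseEnd # r, rP := p, rN := q))"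
  define f where "f = (\<lambda>l (p, q). if is_pos l then (rev (enc_lit l) @ p, q) else (p, rev (enc_lit l) @ q))"
  let ?g = "\<lambda>tp. tp rI \<noteq> Some ClauseEnd"
  let ?b = "Cond (\<lambda>tp. tp rI = Some Plus)
       (xfer rI rP ;; move_while is_bit rI rP) (xfer rI rN ;; move_while is_bit rI rN)"
  have step: "?g (tops (S a (l # ls))) \<and> runs ?b (S a (l # ls)) (5 * n + 7) (S (f l a) ls) \<and>
      length (concat (map enc_lit ls)) \<le> n"
    if n': "length (concat (map enc_lit (l # ls))) \<le> n" for a l ls
  proof -
    obtain p q where a: "a = (p, q)" by (cases a) auto
    define t where "t = concat (map enc_lit ls) @ ClauseEnd # r"
    let ?bs = "enc_nat (var l)"
    let ?s = "s(rI := sign l # ?bs @ t, rP := p, rN := q)"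
    have t: "t = [] \<or> \<not> is_bit (hd t)" using after_lits[of ls r] by (auto simp: t_def is_bit_def)
    have S: "S a (l # ls) = ?s" by (simp add: S_def a t_def enc_lit_eq)
    have len: "length ?bs < n" using n' by (simp add: enc_lit_eq)
    define j where "j = (if is_pos l then rP else rN)"
    have j: "rI \<noteq> j" by (simp add: j_def)
    let ?s1 = "?s(rI := ?bs @ t, j := sign l # ?s j)"
    have 1: "runs (xfer rI j) ?s 4 ?s1"
      by (rule runs_xfer) (use j in simp_all)
    have 2: "runs (move_while is_bit rI j) ?s1 (5 * length ?bs + 1) (?s1(rI := t, j := rev ?bs @ ?s1 j))"
      by (rule runs_move_while) (use j t in \<open>simp_all add: enc_nat_bits\<close>)
    have "runs ?b ?s (5 * n + 7) (S (f l a) ls)"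
    proof (cases "is_pos l")
      case True
      then have "sign l = Plus" by (cases l) auto
      then have c: "tops ?s rI = Some Plus" by (simp add: tops_Cons)
      show ?thesis
        by (rule runs_eqI[OF runs_CondT[of "\<lambda>tp. tp rI = Some Plus", OF c runs_Seq[OF 1 2, unfolded j_def if_P[OF True]]]])
          (use True len in \<open>simp_all add: S_def f_def a t_def fun_eq_iff enc_lit_eq j_def\<close>)
    next
      case False
      then have "sign l = Minus" by (cases l) auto
      then have c: "tops ?s rI \<noteq> Some Plus" by (simp add: tops_def)
      show ?thesis
        by (rule runs_eqI[OF runs_CondF[of "\<lambda>tp. tp rI = Some Plus", OF c runs_Seq[OF 1 2, unfolded j_def if_not_P[OF False]]]])
          (use False len in \<open>simp_all add: S_def f_def a t_def fun_eq_iff enc_lit_eq j_def\<close>)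
    qed
    moreover have "tops ?s rI = Some (sign l)" by (simp add: tops_Cons)
    moreover have "sign l \<noteq> ClauseEnd" by (cases l) auto
    ultimately show ?thesis using n' unfolding S by simp
  qed
  have stop: "\<not> ?g (tops (S a []))" for a
    by (cases a) (simp add: S_def tops_Cons)
  have "runs (Loop ?g ?b) (S (s rP, s rN) ls) ((5 * n + 7 + 1) * length ls + 1) (S (fold f ls (s rP, s rN)) [])"
    by (rule conjunct1, rule runs_Loop_fold[where Inv = "\<lambda>_ ls. length (concat (map enc_lit ls)) \<le> n"])
      (use step stop n in blast)+
  moreover have "fold f ls (p, q) = (toks (pos_lits ls) @ p, toks (neg_lits ls) @ q)" for p q
    by (induction ls arbitrary: p q)
      (simp_all add: f_def pos_lits_def neg_lits_def toks_append toks_Cons toks_Nil enc_lit_eq)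
  moreover have "S (s rP, s rN) ls = s" using I by (simp add: S_def fun_eq_iff)
  ultimately have 1: "runs read_lits s ((5 * n + 7 + 1) * length ls + 1)
      (S (toks (pos_lits ls) @ s rP, toks (neg_lits ls) @ s rN) [])"
    unfolding read_lits_def by simp
  have "length ls \<le> length (concat (map enc_lit ls))"
    by (induction ls) (auto simp: enc_lit_eq)
  then have "(5 * n + 7 + 1) * length ls \<le> (5 * n + 7 + 1) * n" using n by (intro mult_le_mono2) simp
  then have t: "(5 * n + 7 + 1) * length ls + 1 \<le> 8 * (n + 1) ^ 2"
    by (simp add: power2_eq_square algebra_simps)
  show ?thesis
    by (rule runs_eqI[OF 1 _ t]) (simp add: S_def fun_eq_iff)
qed

definition check_head :: "sym com" where
  "check_head = Cond (\<lambda>tp. tp rP = None) (raise_flag rE)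
     (move_while is_bit rP rX ;; dup rX rP rV ;;
      scan rP ;; raise_if (\<lambda>tp. tp rD \<noteq> None) rE ;; clear rM ;; clear rD ;;
      scan rN ;; raise_if (\<lambda>tp. tp rM \<noteq> None) rE ;; clear rM ;; clear rD ;; clear rV)"

text \<open>Comparing every positive literal with the first one, instead of counting them, tolerates
  repeated literals, which a presentation of a clause may contain.\<close>

definition bad_head :: "'v lit list \<Rightarrow> 'v lit list \<Rightarrow> bool" where
  "bad_head ps ns \<longleftrightarrow>
     ps = [] \<or> (\<exists>l\<in>set ps. var l \<noteq> var (hd ps)) \<or> var (hd ps) \<in> var ` set ns"

lemma runs_clear_flag:
  assumes "s i = flag b" shows "runs (clear i) s 3 (s(i := []))"
  by (rule runs_eqI[OF runs_clear]) (use assms length_flag[of b] in simp_all)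

lemma runs_check_head:
  assumes P: "s rP = toks ps" and N: "s rN = toks ns" and E: "s rE = flag e"
    and s: "s rV = []" "s rB = []" "s rU = []" "s rM = []" "s rD = []" "s rX = []"
    and n: "length (toks ps) \<le> n" "length (toks ns) \<le> n"
  shows "runs check_head s (100 * (n + 1) ^ 2) (s(rE := flag (e \<or> bad_head ps ns)))"
proof (cases ps)
  case Nil
  have "tops s rP = None" using P Nil by (simp add: tops_Nil toks_Nil)
  from runs_CondT[of "\<lambda>tp. tp rP = None", OF this runs_raise_flag[of s rE e, OF E]]
  show ?thesis unfolding check_head_def
    by (rule runs_eqI) (simp_all add: Nil bad_head_def)
next
  case (Cons l ps')
  let ?bs = "enc_nat (var l)"
  have c: "tops s rP \<noteq> None" using P Cons by (simp add: tops_None toks_Cons)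
  have len: "length ?bs \<le> n" using n Cons by (simp add: toks_Cons)
  let ?s1 = "s(rP := sign l # toks ps', rX := ?bs)"
  have 1: "runs (move_while is_bit rP rX) s (5 * n + 1) ?s1"
    by (rule runs_eqI[OF runs_move_while[where xs = "rev ?bs" and ys = "sign l # toks ps'"]])
      (use P Cons s len in \<open>simp_all add: toks_Cons sign_not_bit enc_nat_bits fun_eq_iff\<close>)
  let ?s2 = "s(rV := rev ?bs)"
  have 2: "runs (dup rX rP rV) ?s1 (8 * n + 1) ?s2"
    by (rule runs_eqI[OF runs_dup])
      (use P Cons s len in \<open>simp_all add: toks_Cons fun_eq_iff\<close>)
  let ?d = "\<exists>l'\<in>set ps. var l' \<noteq> var l"
  let ?s3 = "?s2(rM := flag (False \<or> var l \<in> var ` set ps), rD := flag (False \<or> ?d))"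
  have 3: "runs (scan rP) ?s2 (30 * (n + 1) ^ 2) ?s3"
    by (rule runs_scan) (use P s n len in \<open>simp_all add: flag_def\<close>)
  let ?s4 = "?s3(rE := flag (e \<or> ?d))"
  have 4: "runs (raise_if (\<lambda>tp. tp rD \<noteq> None) rE) ?s3 4 ?s4"
    by (rule runs_eqI[OF runs_raise_if[where b = e]])
      (use E in \<open>simp_all add: tops_None flag_def\<close>)
  let ?s5 = "?s4(rM := [])"
  have 5: "runs (clear rM) ?s4 3 ?s5"
    by (rule runs_clear_flag[where b = "var l \<in> var ` set ps"]) simp
  let ?s6 = "?s2(rE := flag (e \<or> ?d))"
  have 6: "runs (clear rD) ?s5 3 ?s6"
    by (rule runs_eqI[OF runs_clear_flag[where b = ?d]]) (use s in \<open>simp_all add: fun_eq_iff\<close>)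
  let ?m = "var l \<in> var ` set ns"
  let ?s7 = "?s6(rM := flag (False \<or> ?m), rD := flag (False \<or> (\<exists>l'\<in>set ns. var l' \<noteq> var l)))"
  have 7: "runs (scan rN) ?s6 (30 * (n + 1) ^ 2) ?s7"
    by (rule runs_scan) (use N s n len in \<open>simp_all add: flag_def\<close>)
  let ?s8 = "?s7(rE := flag ((e \<or> ?d) \<or> ?m))"
  have 8: "runs (raise_if (\<lambda>tp. tp rM \<noteq> None) rE) ?s7 4 ?s8"
    by (rule runs_eqI[OF runs_raise_if[where b = "e \<or> ?d"]])
      (simp_all add: tops_None flag_def)
  let ?s9 = "?s8(rM := [])"
  have 9: "runs (clear rM) ?s8 3 ?s9"
    by (rule runs_clear_flag[where b = ?m]) simp
  let ?s10 = "?s9(rD := [])"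
  have 10: "runs (clear rD) ?s9 3 ?s10"
    by (rule runs_clear_flag[where b = "\<exists>l'\<in>set ns. var l' \<noteq> var l"]) simp
  have 11: "runs (clear rV) ?s10 (2 * n + 1) (s(rE := flag (e \<or> bad_head ps ns)))"
    by (rule runs_eqI[OF runs_clear])
      (use s len in \<open>simp_all add: fun_eq_iff bad_head_def Cons disj_assoc\<close>)
  show ?thesis unfolding check_head_def
    by (rule runs_eqI[OF runs_CondF[of "\<lambda>tp. tp rP = None", OF c
          runs_Seq[OF 1 runs_Seq[OF 2 runs_Seq[OF 3 runs_Seq[OF 4 runs_Seq[OF 5 runs_Seq[OF 6
          runs_Seq[OF 7 runs_Seq[OF 8 runs_Seq[OF 9 runs_Seq[OF 10 11]]]]]]]]]]]])
      (simp_all add: power2_eq_square algebra_simps)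
qed

text \<open>The negative literals may be consumed, since each round rereads the clauses from
  \<open>rW\<close>. Two moves give \<open>rV\<close> the orientation that the tokens on
  \<open>rT\<close> have.\<close>

definition check_body :: "sym com" where
  "check_body = Loop (\<lambda>tp. tp rN \<noteq> None)
     (move_while is_bit rN rX ;; move rX rV ;; Pop rN ;;
      scan rT ;; raise_if (\<lambda>tp. tp rM = None) rG ;; clear rM ;; clear rD ;; clear rV)"

lemma runs_check_body:
  assumes N: "s rN = toks ns" and T: "s rT = toks ts" and G: "s rG = flag g"
    and s: "s rV = []" "s rB = []" "s rU = []" "s rM = []" "s rD = []" "s rX = []"
    and n: "length (toks ns) \<le> n" "length (toks ts) \<le> n"
  shows "runs check_body s (61 * (n + 1) ^ 3)
    (s(rN := [], rG := flag (g \<or> \<not> var ` set ns \<subseteq> var ` set ts)))"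
proof -
  define S where "S = (\<lambda>g ns. s(rN := toks ns, rG := flag g))"
  define f where "f = (\<lambda>l g. g \<or> var l \<notin> var ` set ts)"
  let ?g = "\<lambda>tp. tp rN \<noteq> None"
  let ?b = "move_while is_bit rN rX ;; move rX rV ;; Pop rN ;;
      scan rT ;; raise_if (\<lambda>tp. tp rM = None) rG ;; clear rM ;; clear rD ;; clear rV"
  have step: "?g (tops (S g (l # ns))) \<and> runs ?b (S g (l # ns)) (60 * (n + 1) ^ 2) (S (f l g) ns) \<and>
      length (toks ns) \<le> n"
    if n': "length (toks (l # ns)) \<le> n" for g l ns
  proof -
    let ?bs = "enc_nat (var l)"
    have len: "length ?bs \<le> n" using n' by (simp add: toks_Cons)
    let ?s = "s(rN := toks (l # ns), rG := flag g)"
    let ?s1 = "?s(rN := sign l # toks ns, rX := ?bs)"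
    have 1: "runs (move_while is_bit rN rX) ?s (5 * n + 1) ?s1"
      by (rule runs_eqI[OF runs_move_while[where xs = "rev ?bs" and ys = "sign l # toks ns"]])
        (use s len in \<open>simp_all add: toks_Cons sign_not_bit enc_nat_bits fun_eq_iff\<close>)
    let ?s2 = "?s(rN := sign l # toks ns, rV := rev ?bs)"
    have 2: "runs (move rX rV) ?s1 (5 * n + 1) ?s2"
      by (rule runs_eqI[OF runs_move]) (use s len in \<open>simp_all add: fun_eq_iff\<close>)
    let ?s3 = "?s(rN := toks ns, rV := rev ?bs)"
    have 3: "runs (Pop rN) ?s2 1 ?s3"
      by (rule runs_eqI[OF runs_Pop]) (simp_all add: fun_eq_iff)
    let ?m = "var l \<in> var ` set ts"
    let ?d = "\<exists>l'\<in>set ts. var l' \<noteq> var l"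
    let ?s4 = "?s3(rM := flag (False \<or> ?m), rD := flag (False \<or> ?d))"
    have 4: "runs (scan rT) ?s3 (30 * (n + 1) ^ 2) ?s4"
      by (rule runs_scan) (use T s n len in \<open>simp_all add: flag_def\<close>)
    let ?s5 = "?s4(rG := flag (g \<or> \<not> ?m))"
    have 5: "runs (raise_if (\<lambda>tp. tp rM = None) rG) ?s4 4 ?s5"
      by (rule runs_eqI[OF runs_raise_if[where b = g]])
        (simp_all add: tops_None flag_def)
    let ?s6 = "?s5(rM := [])"
    have 6: "runs (clear rM) ?s5 3 ?s6"
      by (rule runs_clear_flag[where b = ?m]) simp
    let ?s7 = "?s6(rD := [])"
    have 7: "runs (clear rD) ?s6 3 ?s7"
      by (rule runs_clear_flag[where b = ?d]) simp
    have 8: "runs (clear rV) ?s7 (2 * n + 1) (S (f l g) ns)"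
      by (rule runs_eqI[OF runs_clear])
        (use s len in \<open>simp_all add: fun_eq_iff S_def f_def\<close>)
    have "runs ?b ?s (60 * (n + 1) ^ 2) (S (f l g) ns)"
      by (rule runs_eqI[OF runs_Seq[OF 1 runs_Seq[OF 2 runs_Seq[OF 3 runs_Seq[OF 4 runs_Seq[OF 5
          runs_Seq[OF 6 runs_Seq[OF 7 8]]]]]]]])
        (simp_all add: power2_eq_square algebra_simps)
    moreover have "tops ?s rN \<noteq> None" by (simp add: tops_None toks_Cons)
    ultimately show ?thesis using n' by (simp add: S_def toks_Cons)
  qed
  have stop: "\<not> ?g (tops (S g []))" for g
    by (simp add: S_def toks_Nil tops_None)
  have "runs (Loop ?g ?b) (S g ns) ((60 * (n + 1) ^ 2 + 1) * length ns + 1) (S (fold f ns g) [])"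
    by (rule conjunct1, rule runs_Loop_fold[where Inv = "\<lambda>_ ns. length (toks ns) \<le> n"])
      (use step stop n(1) in blast)+
  moreover have "fold f ns g = (g \<or> \<not> var ` set ns \<subseteq> var ` set ts)" for g
    by (induction ns arbitrary: g) (auto simp: f_def)
  moreover have "S g ns = s" using N G by (simp add: S_def fun_eq_iff)
  ultimately have 1: "runs check_body s ((60 * (n + 1) ^ 2 + 1) * length ns + 1)
      (S (g \<or> \<not> var ` set ns \<subseteq> var ` set ts) [])"
    unfolding check_body_def by simp
  have "length ns \<le> n" using length_toks[of ns] n by simp
  then have "(60 * (n + 1) ^ 2 + 1) * length ns \<le> (60 * (n + 1) ^ 2 + 1) * n" by (rule mult_le_mono2)
  then have t: "(60 * (n + 1) ^ 2 + 1) * length ns + 1 \<le> 61 * (n + 1) ^ 3"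
    by (simp add: power2_eq_square power3_eq_cube algebra_simps)
  show ?thesis
    by (rule runs_eqI[OF 1 _ t]) (simp add: S_def fun_eq_iff toks_Nil)
qed


text \<open>The head travels to \<open>rT\<close> by way of \<open>rX\<close>: a single move would
  reverse its token and put the sign above the bits.\<close>

definition clause :: "sym com" where
  "clause = read_lits ;; Pop rI ;; check_head ;; check_body ;;
     Cond (\<lambda>tp. tp rG = None) (move rP rX ;; move rX rT) (clear rP) ;; clear rG"

definition clause_update :: "nat lit list \<Rightarrow> nat lit list \<times> bool \<Rightarrow> nat lit list \<times> bool" where
  "clause_update ls = (\<lambda>(ts, e).
     (if var ` set (neg_lits ls) \<subseteq> var ` set ts then pos_lits ls @ ts else ts,
      e \<or> bad_head (pos_lits ls) (neg_lits ls)))"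

lemma length_pos_neg_lits:
  "length (toks (pos_lits ls)) + length (toks (neg_lits ls)) = length (concat (map enc_lit ls))"
  by (induction ls) (simp_all add: pos_lits_def neg_lits_def toks_append toks_Cons toks_Nil enc_lit_eq)

definition idle :: "sym stacks \<Rightarrow> bool" where
  "idle s \<longleftrightarrow> (\<forall>r\<in>{rP, rN, rV, rB, rU, rM, rD, rG, rX}. s r = [])"

lemma runs_clause:
  assumes I: "s rI = enc_clause ls @ r" and T: "s rT = toks ts" and E: "s rE = flag e"
    and s: "idle s"
    and n: "length (enc_clause ls) \<le> n" "length (toks ts) \<le> n"
    and upd: "clause_update ls (ts, e) = (ts', e')"
  shows "runs clause s (200 * (n + 1) ^ 3) (s(rI := r, rT := toks ts', rE := flag e'))"
proof -
  let ?ps = "pos_lits ls" let ?ns = "neg_lits ls"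
  have len: "length (concat (map enc_lit ls)) \<le> n" using n(1) by (simp add: enc_clause_def)
  have lp: "length (toks ?ps) \<le> n" "length (toks ?ns) \<le> n"
    using len length_pos_neg_lits[of ls] by linarith+
  let ?s1 = "s(rI := ClauseEnd # r, rP := toks ?ps, rN := toks ?ns)"
  have 1: "runs read_lits s (8 * (n + 1) ^ 2) ?s1"
    by (rule runs_eqI[OF runs_read_lits[where ls = ls and r = r and n = n]])
      (use I s len in \<open>simp_all add: enc_clause_def idle_def\<close>)
  let ?s2 = "s(rI := r, rP := toks ?ps, rN := toks ?ns)"
  have 2: "runs (Pop rI) ?s1 1 ?s2"
    by (rule runs_eqI[OF runs_Pop]) (simp_all add: fun_eq_iff)
  let ?s3 = "?s2(rE := flag (e \<or> bad_head ?ps ?ns))"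
  have 3: "runs check_head ?s2 (100 * (n + 1) ^ 2) ?s3"
    by (rule runs_check_head) (use E s lp in \<open>simp_all add: idle_def\<close>)
  define g where "g \<longleftrightarrow> \<not> var ` set ?ns \<subseteq> var ` set ts"
  let ?s4 = "?s3(rN := [], rG := flag g)"
  have 4: "runs check_body ?s3 (61 * (n + 1) ^ 3) ?s4"
    by (rule runs_eqI[OF runs_check_body[where ns = ?ns and ts = ts and g = False and n = n]])
      (use T s lp n in \<open>simp_all add: idle_def flag_def g_def\<close>)
  let ?g = "\<lambda>tp. tp rG = (None :: sym option)"
  let ?s5 = "s(rI := r, rT := toks ts', rE := flag e', rG := flag g)"
  have e': "e' \<longleftrightarrow> e \<or> bad_head ?ps ?ns" using upd by (simp add: clause_update_def)
  have 5: "runs (Cond ?g (move rP rX ;; move rX rT) (clear rP)) ?s4 (10 * n + 4) ?s5"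
  proof (cases g)
    case True
    have c: "\<not> ?g (tops ?s4)" using True by (simp add: tops_None flag_def)
    have ts': "ts' = ts" using upd True by (simp add: clause_update_def g_def)
    show ?thesis
      by (rule runs_eqI[OF runs_CondF[of ?g, OF c runs_clear]])
        (use s T lp in \<open>simp_all add: fun_eq_iff idle_def ts' e'\<close>)
  next
    case False
    have c: "?g (tops ?s4)" using False by (simp add: tops_None flag_def)
    have ts': "ts' = ?ps @ ts" using upd False by (simp add: clause_update_def g_def)
    let ?t = "?s4(rP := [], rX := rev (toks ?ps))"
    have a: "runs (move rP rX) ?s4 (5 * n + 1) ?t"
      by (rule runs_eqI[OF runs_move]) (use s lp in \<open>simp_all add: fun_eq_iff idle_def\<close>)
    have b: "runs (move rX rT) ?t (5 * n + 1) ?s5"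
      by (rule runs_eqI[OF runs_move])
        (use s T lp in \<open>simp_all add: fun_eq_iff idle_def ts' e' toks_append\<close>)
    show ?thesis
      by (rule runs_eqI[OF runs_CondT[of ?g, OF c runs_Seq[OF a b]]]) simp_all
  qed
  have 6: "runs (clear rG) ?s5 3 (s(rI := r, rT := toks ts', rE := flag e'))"
    by (rule runs_eqI[OF runs_clear_flag[where b = g]]) (use s in \<open>simp_all add: fun_eq_iff idle_def\<close>)
  show ?thesis unfolding clause_def
    by (rule runs_eqI[OF runs_Seq[OF 1 runs_Seq[OF 2 runs_Seq[OF 3 runs_Seq[OF 4 runs_Seq[OF 5 6]]]]]])
      (simp_all add: power2_eq_square power3_eq_cube algebra_simps)
qed

definition chain_round :: "sym com" where
  "chain_round = move rW rX ;; dup rX rI rW ;; Loop (\<lambda>tp. tp rI \<noteq> Some Sep) clause ;;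
     Pop rI ;; move_while is_bit rI rV ;; scan rT ;; raise_if (\<lambda>tp. tp rM \<noteq> None) rF ;;
     clear rM ;; clear rD ;; clear rV ;; clear rI"

definition round_update ::
  "nat lit list list \<Rightarrow> nat \<Rightarrow> nat lit list \<times> bool \<times> bool \<Rightarrow> nat lit list \<times> bool \<times> bool" where
  "round_update cls x = (\<lambda>(ts, e, f). case fold clause_update cls (ts, e) of
     (ts', e') \<Rightarrow> (ts', e', f \<or> x \<in> var ` set ts'))"

text \<open>Repetitions on the derived list are never removed, so its growth has to be paid for: a
  clause adds at most its positive literals, hence no more than its own encoding.\<close>

lemma length_clause_update:
  "length (toks (fst (clause_update ls a))) \<le> length (toks (fst a)) + length (enc_clause ls)"
  using length_pos_neg_lits[of ls]
  by (cases a) (simp add: clause_update_def toks_append enc_clause_def)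

lemma length_fold_clause_update:
  "length (toks (fst (fold clause_update cls a))) \<le> length (toks (fst a)) + length (concat (map enc_clause cls))"
proof (induction cls arbitrary: a)
  case (Cons c cls)
  show ?case using Cons[of "clause_update c a"] length_clause_update[of c a] by simp
qed simp

lemma runs_chain_round:
  assumes W: "s rW = enc_instance cls x k" and T: "s rT = toks ts" and E: "s rE = flag e"
    and F: "s rF = flag f" and I: "s rI = []" and s: "idle s"
    and n: "length (toks ts) + length (enc_instance cls x k) \<le> n"
    and upd: "round_update cls x (ts, e, f) = (ts', e', f')"
  shows "runs chain_round s (300 * (n + 1) ^ 4) (s(rT := toks ts', rE := flag e', rF := flag f'))"
proof -
  let ?w = "enc_instance cls x k"
  define r where "r = enc_nat x @ Sep # enc_nat k"
  have w: "?w = concat (map enc_clause cls) @ Sep # r" by (simp add: enc_instance_def r_def)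
  have len: "length ?w \<le> n" using n by simp
  have lens: "length (enc_nat x) \<le> n" "length (enc_nat k) \<le> n"
    using len by (simp_all add: enc_instance_def)
  let ?s1 = "s(rW := [], rX := rev ?w)"
  have 1: "runs (move rW rX) s (5 * n + 1) ?s1"
    by (rule runs_eqI[OF runs_move]) (use W s len in \<open>simp_all add: fun_eq_iff idle_def\<close>)
  let ?s2 = "s(rI := ?w)"
  have 2: "runs (dup rX rI rW) ?s1 (8 * n + 1) ?s2"
    by (rule runs_eqI[OF runs_dup]) (use W I s len in \<open>simp_all add: fun_eq_iff idle_def\<close>)
  define S where "S = (\<lambda>(ts, e) cs. s(rI := concat (map enc_clause cs) @ Sep # r,
    rT := toks ts, rE := flag e))"
  let ?g = "\<lambda>tp. tp rI \<noteq> Some Sep"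
  \<comment> \<open>A potential: the symbols a clause adds to \<open>rT\<close> are covered by those
    it removes from the unread input, so \<open>n\<close> bounds both throughout the round.\<close>
  define Inv :: "nat lit list \<times> bool \<Rightarrow> nat lit list list \<Rightarrow> bool"
    where "Inv = (\<lambda>a cs. length (toks (fst a)) + length (concat (map enc_clause cs)) \<le> n)"
  have step: "?g (tops (S a (c # cs))) \<and> runs clause (S a (c # cs)) (200 * (n + 1) ^ 3) (S (clause_update c a) cs) \<and>
      Inv (clause_update c a) cs"
    if inv: "Inv a (c # cs)" for a c cs
  proof -
    obtain ts e where a: "a = (ts, e)" by (cases a) auto
    obtain ts' e' where u: "clause_update c (ts, e) = (ts', e')" by (cases "clause_update c (ts, e)") auto
    let ?s = "S a (c # cs)"
    have "runs clause ?s (200 * (n + 1) ^ 3)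
        (?s(rI := concat (map enc_clause cs) @ Sep # r, rT := toks ts', rE := flag e'))"
      by (rule runs_clause[OF _ _ _ _ _ _ u])
        (use s inv in \<open>simp_all add: S_def a idle_def Inv_def\<close>)
    then have "runs clause ?s (200 * (n + 1) ^ 3) (S (clause_update c a) cs)"
      by (rule runs_eqI) (simp_all add: S_def a u fun_eq_iff)
    moreover have "Inv (clause_update c a) cs"
      using inv length_clause_update[of c a] by (simp add: Inv_def)
    \<comment> \<open>An encoded clause starts with a sign or, if empty, with
      \<open>ClauseEnd\<close>, never with \<open>Sep\<close>.\<close>
    moreover have "?g (tops ?s)"
      by (cases c; cases "hd c") (simp_all add: S_def a tops_def enc_clause_def)
    ultimately show ?thesis by blast
  qed
  have stop: "\<not> ?g (tops (S a []))" for a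
    by (cases a) (simp add: S_def tops_Cons)
  obtain ts1 e1 where u: "fold clause_update cls (ts, e) = (ts1, e1)"
    by (cases "fold clause_update cls (ts, e)") auto
  have f': "ts' = ts1" "e' = e1" "f' = (f \<or> x \<in> var ` set ts1)"
    using upd u by (auto simp: round_update_def)
  have "runs (Loop ?g clause) (S (ts, e) cls) ((200 * (n + 1) ^ 3 + 1) * length cls + 1)
      (S (fold clause_update cls (ts, e)) [])"
    by (rule conjunct1, rule runs_Loop_fold[where Inv = Inv])
      (use step stop n in \<open>blast, blast, simp add: Inv_def w\<close>)
  moreover have S0: "S (ts, e) cls = ?s2" using T E by (simp add: S_def fun_eq_iff w)
  ultimately have 3: "runs (Loop ?g clause) ?s2 ((200 * (n + 1) ^ 3 + 1) * length cls + 1) (S (ts1, e1) [])"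
    by (simp only: u S0)
  let ?s3 = "S (ts1, e1) []"
  let ?s4 = "?s3(rI := r)"
  have 4: "runs (Pop rI) ?s3 1 ?s4"
    by (rule runs_eqI[OF runs_Pop]) (simp_all add: S_def)
  let ?s5 = "?s3(rI := Sep # enc_nat k, rV := rev (enc_nat x))"
  have 5: "runs (move_while is_bit rI rV) ?s4 (5 * n + 1) ?s5"
    by (rule runs_eqI[OF runs_move_while[where xs = "enc_nat x" and ys = "Sep # enc_nat k"]])
      (use s lens in \<open>simp_all add: S_def r_def fun_eq_iff idle_def is_bit_def enc_nat_bits[unfolded is_bit_def]\<close>)
  let ?m = "x \<in> var ` set ts1"
  let ?d = "\<exists>l\<in>set ts1. var l \<noteq> x"
  let ?s6 = "?s5(rM := flag (False \<or> ?m), rD := flag (False \<or> ?d))"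
  have lt1: "length (toks ts1) \<le> n"
    using length_fold_clause_update[of cls "(ts, e)"] n u by (simp add: w)
  have 6: "runs (scan rT) ?s5 (30 * (n + 1) ^ 2) ?s6"
    by (rule runs_scan) (use s lens lt1 in \<open>simp_all add: S_def idle_def flag_def\<close>)
  let ?s7 = "?s6(rF := flag (f \<or> ?m))"
  have 7: "runs (raise_if (\<lambda>tp. tp rM \<noteq> None) rF) ?s6 4 ?s7"
    by (rule runs_eqI[OF runs_raise_if[where b = f]]) (use F in \<open>simp_all add: S_def tops_None flag_def\<close>)
  let ?s8 = "?s7(rM := [])"
  have 8: "runs (clear rM) ?s7 3 ?s8"
    by (rule runs_clear_flag[where b = ?m]) simp
  let ?s9 = "?s8(rD := [])"
  have 9: "runs (clear rD) ?s8 3 ?s9"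
    by (rule runs_clear_flag[where b = ?d]) simp
  let ?s10 = "?s9(rV := [])"
  have 10: "runs (clear rV) ?s9 (2 * n + 1) ?s10"
    by (rule runs_eqI[OF runs_clear]) (use lens in simp_all)
  \<comment> \<open>What is left on \<open>rI\<close> is \<open>Sep\<close> and the encoded bound,
    at most \<open>n + 1\<close> symbols.\<close>
  have 11: "runs (clear rI) ?s10 (2 * n + 3) (s(rT := toks ts', rE := flag e', rF := flag f'))"
    by (rule runs_eqI[OF runs_clear]) (use lens s I in \<open>simp_all add: S_def fun_eq_iff idle_def f'\<close>)
  have "length cls \<le> n"
  proof -
    have "length cls \<le> length (concat (map enc_clause cls))"
      by (induction cls) (simp_all add: enc_clause_def)
    then show ?thesis using len w by simp
  qed
  then have "(200 * (n + 1) ^ 3 + 1) * length cls \<le> (200 * (n + 1) ^ 3 + 1) * n" by (rule mult_le_mono2)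
  then have 3: "runs (Loop ?g clause) ?s2 ((200 * (n + 1) ^ 3 + 1) * n + 1) ?s3"
    by (intro runs_eqI[OF 3]) simp_all
  show ?thesis unfolding chain_round_def
    by (rule runs_eqI[OF runs_Seq[OF 1 runs_Seq[OF 2 runs_Seq[OF 3 runs_Seq[OF 4 runs_Seq[OF 5
        runs_Seq[OF 6 runs_Seq[OF 7 runs_Seq[OF 8 runs_Seq[OF 9 runs_Seq[OF 10 11]]]]]]]]]]])
      (simp_all add: power2_eq_square power3_eq_cube power4_eq_xxxx algebra_simps)
qed

section \<open>Correctness of forward chaining\<close>

lemma set_pos_lits: "var ` set (pos_lits ls) = {v. Pos v \<in> set ls}"
proof -
  have "v \<in> var ` set (pos_lits ls)" if "Pos v \<in> set ls" for v
    using that by (intro image_eqI[of _ _ "Pos v"]) (simp_all add: pos_lits_def)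
  moreover have "Pos (var l) \<in> set ls" if "l \<in> set (pos_lits ls)" for l
    by (cases l; use that in \<open>simp add: pos_lits_def\<close>)
  ultimately show ?thesis by blast
qed

lemma set_neg_lits: "var ` set (neg_lits ls) = {v. Neg v \<in> set ls}"
proof -
  have "v \<in> var ` set (neg_lits ls)" if "Neg v \<in> set ls" for v
    using that by (intro image_eqI[of _ _ "Neg v"]) (simp_all add: neg_lits_def)
  moreover have "Neg (var l) \<in> set ls" if "l \<in> set (neg_lits ls)" for l
    by (cases l; use that in \<open>simp add: neg_lits_def\<close>)
  ultimately show ?thesis by blast
qed

text \<open>Once the first positive variable is known to be the only one, a complementary pair can
  only involve that variable, so a single lookup among the negative literals decides
  \<open>is_clause\<close>.\<close>

lemma bad_head_iff:
  "\<not> bad_head (pos_lits ls) (neg_lits ls) \<longleftrightarrow> (\<exists>!v. Pos v \<in> set ls) \<and> is_clause (set ls)"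
proof (cases "pos_lits ls")
  case Nil
  then have "\<nexists>v. Pos v \<in> set ls" using set_pos_lits[of ls] by auto
  then show ?thesis using Nil by (auto simp: bad_head_def)
next
  case (Cons l ps)
  let ?h = "var l"
  have P: "{v. Pos v \<in> set ls} = insert ?h (var ` set ps)" using Cons set_pos_lits[of ls] by simp
  have "\<not> bad_head (pos_lits ls) (neg_lits ls) \<longleftrightarrow>
      {v. Pos v \<in> set ls} = {?h} \<and> Neg ?h \<notin> set ls"
    using P Cons by (auto simp: bad_head_def set_neg_lits)
  also have "\<dots> \<longleftrightarrow> (\<exists>!v. Pos v \<in> set ls) \<and> is_clause (set ls)"
  proof -
    have h: "Pos ?h \<in> set ls" using P by blast
    have "{v. Pos v \<in> set ls} = {?h} \<longleftrightarrow> (\<forall>v. Pos v \<in> set ls \<longrightarrow> v = ?h)" using h by blast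
    also have "\<dots> \<longleftrightarrow> (\<exists>!v. Pos v \<in> set ls)" using h by blast
    finally have "{v. Pos v \<in> set ls} = {?h} \<longleftrightarrow> (\<exists>!v. Pos v \<in> set ls)" .
    moreover have "is_clause (set ls) \<longleftrightarrow> Neg ?h \<notin> set ls" if "{v. Pos v \<in> set ls} = {?h}"
    proof -
      have "v = ?h" if "Pos v \<in> set ls" for v
        using that \<open>{v. Pos v \<in> set ls} = {?h}\<close> by blast
      then show ?thesis using h unfolding is_clause_def by blast
    qed
    ultimately show ?thesis by blast
  qed
  finally show ?thesis .
qed

lemma definite_Horn_formula_of:
  "formula_of cls \<in> definite_Horn \<longleftrightarrow> (\<forall>ls\<in>set cls. \<not> bad_head (pos_lits ls) (neg_lits ls))"
  unfolding bad_head_iff by (auto simp: definite_Horn_def is_cnf_def formula_of_def)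

definition fire :: "'v lit list \<Rightarrow> 'v set \<Rightarrow> 'v set" where
  "fire ls A = (if {v. Neg v \<in> set ls} \<subseteq> A then {v. Pos v \<in> set ls} \<union> A else A)"

lemma fold_clause_update:
  assumes "fold clause_update cls (ts, e) = (ts', e')"
  shows "var ` set ts' = fold fire cls (var ` set ts)"
    and "e' \<longleftrightarrow> e \<or> (\<exists>ls\<in>set cls. bad_head (pos_lits ls) (neg_lits ls))"
proof -
  have "var ` set ts' = fold fire cls (var ` set ts) \<and>
      (e' \<longleftrightarrow> e \<or> (\<exists>ls\<in>set cls. bad_head (pos_lits ls) (neg_lits ls)))"
    using assms
  proof (induction cls arbitrary: ts e)
    case (Cons ls cls)
    obtain ts1 e1 where u: "clause_update ls (ts, e) = (ts1, e1)" by fastforce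
    have "var ` set ts1 = fire ls (var ` set ts)"
    proof -
      have "ts1 = (if {v. Neg v \<in> set ls} \<subseteq> var ` set ts then pos_lits ls @ ts else ts)"
        using u by (simp add: clause_update_def set_neg_lits)
      then show ?thesis by (simp add: fire_def image_Un set_pos_lits)
    qed
    moreover have "e1 \<longleftrightarrow> e \<or> bad_head (pos_lits ls) (neg_lits ls)"
      using u by (auto simp: clause_update_def)
    moreover have "fold clause_update cls (ts1, e1) = (ts', e')" using Cons.prems u by simp
    ultimately show ?case using Cons.IH[of ts1 e1] by auto
  qed simp
  then show "var ` set ts' = fold fire cls (var ` set ts)"
    and "e' \<longleftrightarrow> e \<or> (\<exists>ls\<in>set cls. bad_head (pos_lits ls) (neg_lits ls))" by blast+
qed

lemma fire_mono: "A \<subseteq> fire ls A"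
  by (auto simp: fire_def)

lemma fold_fire_mono: "A \<subseteq> fold fire cls A"
proof (induction cls arbitrary: A)
  case (Cons ls cls)
  then show ?case using fire_mono[of A ls] by auto
qed simp

text \<open>Firing only adds variables, so the set after the first clause is squeezed between
  \<open>A\<close> and the result of the pass, which is \<open>A\<close> again.\<close>

lemma fold_fire_fixed: "fold fire cls A = A \<Longrightarrow> ls \<in> set cls \<Longrightarrow> fire ls A = A"
proof (induction cls)
  case (Cons c cls)
  have "fire c A \<subseteq> fold fire cls (fire c A)" by (rule fold_fire_mono)
  then have "fire c A = A" using Cons.prems(1) fire_mono[of A c] by simp
  then show ?case using Cons by auto
qed simp

text \<open>Used with \<open>B\<close> the true variables of a model, for soundness, and with
  \<open>B\<close> the set of heads, for termination.\<close>

lemma fold_fire_subset: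
  "A \<subseteq> B \<Longrightarrow> (\<And>ls C. ls \<in> set cls \<Longrightarrow> C \<subseteq> B \<Longrightarrow> fire ls C \<subseteq> B) \<Longrightarrow> fold fire cls A \<subseteq> B"
proof (induction cls arbitrary: A)
  case (Cons c cls)
  have "fire c A \<subseteq> B" using Cons.prems by simp
  then show ?case using Cons.IH[of "fire c A"] Cons.prems(2) by simp
qed simp

lemma funpow_subset:
  assumes "\<And>A. A \<subseteq> B \<Longrightarrow> F A \<subseteq> B" shows "((F ^^ n) {} :: 'a set) \<subseteq> B"
  by (induction n) (use assms in auto)

text \<open>Derived variables are true in every model. Conversely, they are heads, of which there
  are at most \<open>length cls\<close>; so the iteration is stationary after \<open>n\<close>
  rounds, its result is closed under the clauses, and a closed set contains every entailed
  variable.\<close>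

lemma forward_chaining_correct:
  assumes horn: "formula_of cls \<in> definite_Horn" and n: "length cls \<le> n"
  shows "x \<in> (fold fire cls ^^ n) {} \<longleftrightarrow> entails (formula_of cls) {{Pos x}}"
proof
  let ?F = "fold fire cls"
  have uniq: "\<exists>!v. Pos v \<in> C" if "C \<in> formula_of cls" for C
    using that horn by (simp add: definite_Horn_def)
  assume x: "x \<in> (?F ^^ n) {}"
  show "entails (formula_of cls) {{Pos x}}"
  proof (rule entails_PosI)
    fix \<tau> assume \<tau>: "satisfies \<tau> (formula_of cls)"
    have "fire ls A \<subseteq> {v. \<tau> v}" if ls: "ls \<in> set cls" and A: "A \<subseteq> {v. \<tau> v}" for ls A
    proof (cases "{v. Neg v \<in> set ls} \<subseteq> A")
      case True
      have f: "set ls \<in> formula_of cls" using ls by (simp add: formula_of_def)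
      then obtain l where l: "l \<in> set ls" "sat_lit \<tau> l" using \<tau> by (auto simp: satisfies_def)
      \<comment> \<open>The variables of the body lie in \<open>A\<close> and are true, so a
        satisfied literal cannot be negative.\<close>
      have "\<exists>v. l = Pos v" by (cases l; use l True A in auto)
      then obtain v where v: "l = Pos v" by blast
      then have "{v. Pos v \<in> set ls} \<subseteq> {v. \<tau> v}" using l uniq[OF f] by auto
      then show ?thesis using A by (simp add: fire_def)
    next
      case False then show ?thesis using A by (simp add: fire_def)
    qed
    then have "(?F ^^ n) {} \<subseteq> {v. \<tau> v}" by (intro funpow_subset fold_fire_subset) simp_all
    then show "\<tau> x" using x by blast
  qed
next
  let ?F = "fold fire cls"
  have uniq: "\<exists>!v. Pos v \<in> C" if "C \<in> formula_of cls" for C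
    using that horn by (simp add: definite_Horn_def)
  assume ent: "entails (formula_of cls) {{Pos x}}"
  define head where "head = (\<lambda>ls::nat lit list. THE v. Pos v \<in> set ls)"
  have head: "v = head ls" if "ls \<in> set cls" "Pos v \<in> set ls" for ls v
  proof -
    have "\<exists>!v. Pos v \<in> set ls" using uniq[of "set ls"] that(1) by (simp add: formula_of_def)
    then show ?thesis unfolding head_def using that(2) by (rule the1_equality[symmetric])
  qed
  let ?H = "head ` set cls"
  have "fire ls A \<subseteq> ?H" if "ls \<in> set cls" "A \<subseteq> ?H" for ls A
    using that head by (auto simp: fire_def split: if_splits)
  then have H: "(?F ^^ i) {} \<subseteq> ?H" for i by (intro funpow_subset fold_fire_subset) simp_all
  have "card ?H \<le> n" using n card_image_le[of "set cls" head] card_length[of cls] by simp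
  then have fixed: "?F ((?F ^^ n) {}) = (?F ^^ n) {}"
    using H by (intro funpow_stationary[where H = ?H] fold_fire_mono) simp_all
  have "Horn_closed (formula_of cls) ((?F ^^ n) {})"
    unfolding Horn_closed_def
  proof (intro ballI allI impI)
    fix C v assume C: "C \<in> formula_of cls" "Pos v \<in> C" "{u. Neg u \<in> C} \<subseteq> (?F ^^ n) {}"
    then obtain ls where ls: "ls \<in> set cls" "C = set ls" by (auto simp: formula_of_def)
    have "fire ls ((?F ^^ n) {}) = (?F ^^ n) {}" using fold_fire_fixed[OF fixed ls(1)] .
    then show "v \<in> (?F ^^ n) {}" using C(2,3) ls(2) by (auto simp: fire_def)
  qed
  then show "x \<in> (?F ^^ n) {}" using entails_closed[OF ex1_implies_ex[OF uniq] _ ent] by blast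
qed

lemma funpow_round_update:
  assumes "(round_update cls x ^^ n) ([], False, False) = (ts, e, f)" "n \<ge> 1"
  shows "e \<longleftrightarrow> (\<exists>ls\<in>set cls. bad_head (pos_lits ls) (neg_lits ls))"
    and "f \<longleftrightarrow> x \<in> (fold fire cls ^^ n) {}"
proof -
  let ?B = "\<exists>ls\<in>set cls. bad_head (pos_lits ls) (neg_lits ls)"
  \<comment> \<open>The error flag starts lowered and gets its final value in the first round,
    whence \<open>n \<ge> 1\<close>. \<open>f\<close> accumulates over the rounds, but as the
    derived sets only grow it reflects the last one.\<close>
  have "var ` set ts = (fold fire cls ^^ n) {} \<and> (e \<longleftrightarrow> n \<ge> 1 \<and> ?B) \<and>
      (f \<longleftrightarrow> x \<in> (fold fire cls ^^ n) {})"
    using assms(1)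
  proof (induction n arbitrary: ts e f)
    case (Suc n)
    obtain ts1 e1 f1 where u: "(round_update cls x ^^ n) ([], False, False) = (ts1, e1, f1)"
      by (metis prod_cases3)
    obtain ts2 e2 where v: "fold clause_update cls (ts1, e1) = (ts2, e2)" by fastforce
    have "ts = ts2" "e = e2" "f \<longleftrightarrow> f1 \<or> x \<in> var ` set ts2"
      using Suc.prems u v by (auto simp: round_update_def)
    then show ?case
      using Suc.IH[OF u] fold_clause_update[OF v] fold_fire_mono[of "(fold fire cls ^^ n) {}" cls] by auto
  qed simp
  then show "e \<longleftrightarrow> ?B" "f \<longleftrightarrow> x \<in> (fold fire cls ^^ n) {}"
    using assms(2) by blast+
qed

text \<open>The set of all variables is trivially closed. This supplies the requirement of the
  language that \<open>x\<close> occur in the formula for every accepted instance.\<close>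

lemma entails_Vars:
  assumes "formula_of cls \<in> definite_Horn" "entails (formula_of cls) {{Pos x}}"
  shows "x \<in> Vars (formula_of cls)"
proof -
  have "Horn_closed (formula_of cls) (Vars (formula_of cls))"
    unfolding Horn_closed_def Vars_def by force
  moreover have "\<exists>v. Pos v \<in> C" if "C \<in> formula_of cls" for C
    using that assms(1) unfolding definite_Horn_def by blast
  ultimately show ?thesis using entails_closed[OF _ _ assms(2)] by blast
qed

lemma rounds_correct:
  assumes "(round_update cls x ^^ n) ([], False, False) = (ts, e, f)"
    and "n \<ge> 1" "length cls \<le> n" "k \<ge> 1"
  shows "f \<and> \<not> e \<longleftrightarrow> formula_of cls \<in> definite_Horn \<and> x \<in> Vars (formula_of cls) \<and>
    iterative_k_backbone k (formula_of cls) x"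
proof (cases "formula_of cls \<in> definite_Horn")
  case True
  have "f \<longleftrightarrow> entails (formula_of cls) {{Pos x}}"
    using funpow_round_update(2)[OF assms(1,2)] forward_chaining_correct[OF True assms(3), of x] by simp
  moreover have "\<not> e"
    using funpow_round_update(1)[OF assms(1,2)] True by (simp add: definite_Horn_formula_of)
  ultimately show ?thesis
    using True iterative_backbone_iff_entails[OF True assms(4), of x] entails_Vars[OF True, of x] by metis
next
  case False
  then have e using funpow_round_update(1)[OF assms(1,2)] by (simp add: definite_Horn_formula_of)
  then show ?thesis using False by simp
qed

section \<open>Parsing\<close>

definition head_opt :: "'a list \<Rightarrow> 'a option" where
  "head_opt xs = (case xs of [] \<Rightarrow> None | a # _ \<Rightarrow> Some a)"

lemma head_opt_simps [simp]: "head_opt [] = None" "head_opt (a # xs) = Some a"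
  by (simp_all add: head_opt_def)

lemma tops_head_opt: "tops s i = head_opt (s i)"
  by (simp add: tops_def head_opt_def)

text \<open>States of the parser: \<open>None\<close> or \<open>Plus\<close> inside the clauses, \<open>Sep\<close> inside the variable,
  \<open>Minus\<close> inside the bound, \<open>ClauseEnd\<close> after an error. Rejecting any non-bit after \<open>Bit0\<close>
  enforces that binary numbers have no superfluous zeros.\<close>

definition next_section :: "sym option \<Rightarrow> sym option \<Rightarrow> sym \<Rightarrow> sym" where
  "next_section sec prev a =
    (if sec = None \<or> sec = Some Plus then
       (if a = Sep then (if prev = None \<or> prev = Some ClauseEnd then Sep else ClauseEnd)
        else if is_bit a then (if prev = None \<or> prev = Some ClauseEnd then ClauseEnd else Plus)
        else (if prev = Some Bit0 then ClauseEnd else Plus))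
     else if sec = Some Sep then
       (if is_bit a then Sep else if a = Sep \<and> prev \<noteq> Some Bit0 then Minus else ClauseEnd)
     else if sec = Some Minus \<and> is_bit a then Minus else ClauseEnd)"

primrec sections :: "sym list \<Rightarrow> sym list" where
  "sections [] = []"
| "sections (a # qs) = next_section (head_opt (sections qs)) (head_opt qs) a # sections qs"

definition well_formed :: "sym list \<Rightarrow> bool" where
  "well_formed w \<longleftrightarrow> head_opt (sections (rev w)) = Some Minus \<and> head_opt (rev w) = Some Bit1"

abbreviation enc_clauses :: "nat lit list list \<Rightarrow> sym list" where
  "enc_clauses cls \<equiv> concat (map enc_clause cls)"

abbreviation enc_lits :: "nat lit list \<Rightarrow> sym list" where
  "enc_lits ls \<equiv> concat (map enc_lit ls)"

lemma enc_nat_eq_Nil: "enc_nat n = [] \<longleftrightarrow> n = 0"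
  by (subst enc_nat.simps) simp

lemma last_enc_nat: "n \<noteq> 0 \<Longrightarrow> last (enc_nat n) = Bit1"
proof (induction n rule: less_induct)
  case (less n)
  show ?case
  proof (cases "n = 1")
    case True
    then show ?thesis using enc_nat.simps[of 1] enc_nat.simps[of 0] by simp
  next
    case False
    then have "n div 2 \<noteq> 0" "n div 2 < n" using less.prems by auto
    then show ?thesis
      using less.IH[of "n div 2"] enc_nat.simps[of n] less.prems by (simp add: enc_nat_eq_Nil)
  qed
qed

lemma ex_enc_nat:
  "\<forall>a\<in>set bs. is_bit a \<Longrightarrow> bs = [] \<or> last bs = Bit1 \<Longrightarrow> \<exists>n. bs = enc_nat n"
proof (induction bs)
  case Nil
  then show ?case by (metis enc_nat_eq_Nil)
next
  case (Cons b bs)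
  have "bs = [] \<or> last bs = Bit1" using Cons.prems(2) by (cases bs) auto
  then obtain n where n: "bs = enc_nat n" using Cons by auto
  let ?m = "2 * n + (if b = Bit1 then 1 else 0)"
  have b: "b = Bit0 \<or> b = Bit1" using Cons.prems(1) by (simp add: is_bit_def)
  \<comment> \<open>If \<open>n = 0\<close> then \<open>bs\<close> is empty, so \<open>b\<close> is
    the last bit and equals \<open>Bit1\<close>.\<close>
  have "?m \<noteq> 0" using Cons.prems(2) n enc_nat_eq_Nil[of n] by auto
  then have "b # bs = enc_nat ?m" using b n enc_nat.simps[of ?m] by auto
  then show ?case by blast
qed

text \<open>The first of four predicates giving the meaning of the parser states.
  \<open>at_clause\<close> and \<open>in_lit\<close> share the states \<open>None\<close> and
  \<open>Plus\<close> and are told apart by the previous symbol.\<close>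

definition at_clause :: "sym list \<Rightarrow> bool" where
  "at_clause u \<longleftrightarrow> (\<exists>cls. u = enc_clauses cls)"

definition in_lit :: "sym list \<Rightarrow> bool" where
  "in_lit u \<longleftrightarrow> (\<exists>cls ls a bs. u = enc_clauses cls @ enc_lits ls @ a # bs \<and>
     (a = Plus \<or> a = Minus) \<and> (\<forall>b\<in>set bs. is_bit b))"

definition in_var :: "sym list \<Rightarrow> bool" where
  "in_var u \<longleftrightarrow> (\<exists>cls bs. u = enc_clauses cls @ Sep # bs \<and> (\<forall>b\<in>set bs. is_bit b))"

definition in_bound :: "sym list \<Rightarrow> bool" where
  "in_bound u \<longleftrightarrow> (\<exists>cls x bs. u = enc_clauses cls @ Sep # enc_nat x @ Sep # bs \<and> (\<forall>b\<in>set bs. is_bit b))"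

lemma head_opt_rev: "head_opt (rev u) = (if u = [] then None else Some (last u))"
  by (cases u rule: rev_cases) simp_all

lemma at_clause_prev: "at_clause u \<Longrightarrow> u = [] \<or> last u = ClauseEnd"
proof -
  assume "at_clause u"
  then obtain cls where "u = enc_clauses cls" by (auto simp: at_clause_def)
  then show ?thesis by (cases cls rule: rev_cases) (auto simp: enc_clause_def)
qed

lemma in_lit_prev: "in_lit u \<Longrightarrow> u \<noteq> [] \<and> last u \<noteq> ClauseEnd"
  unfolding in_lit_def is_bit_def using last_in_set by (fastforce split: if_splits)

lemma at_clause_Sep: "at_clause u \<Longrightarrow> in_var (u @ [Sep])"
  unfolding at_clause_def in_var_def by force

lemma at_clause_ClauseEnd: "at_clause u \<Longrightarrow> at_clause (u @ [ClauseEnd])"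
proof -
  assume "at_clause u"
  then obtain cls where "u = enc_clauses cls" by (auto simp: at_clause_def)
  then have "u @ [ClauseEnd] = enc_clauses (cls @ [[]])" by (simp add: enc_clause_def)
  then show ?thesis unfolding at_clause_def by blast
qed

lemma at_clause_sign: "at_clause u \<Longrightarrow> a = Plus \<or> a = Minus \<Longrightarrow> in_lit (u @ [a])"
proof -
  assume "at_clause u" and a: "a = Plus \<or> a = Minus"
  then obtain cls where "u = enc_clauses cls" by (auto simp: at_clause_def)
  then have "u @ [a] = enc_clauses cls @ enc_lits [] @ a # []" by simp
  then show ?thesis unfolding in_lit_def using a by (metis empty_iff list.set(1))
qed

text \<open>The literal being read always counts as unfinished. Unless its last symbol is
  \<open>Bit0\<close>, its bits already form a numeral, possibly the empty one for zero, and it can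
  be closed.\<close>

lemma in_lit_complete:
  assumes "in_lit u" "last u \<noteq> Bit0"
  obtains cls ls where "u = enc_clauses cls @ enc_lits ls"
proof -
  obtain cls ls a bs where u: "u = enc_clauses cls @ enc_lits ls @ a # bs"
    and a: "a = Plus \<or> a = Minus" and bs: "\<forall>b\<in>set bs. is_bit b"
    using assms(1) unfolding in_lit_def by blast
  have "bs = [] \<or> last bs = Bit1"
  proof (cases "bs = []")
    case False
    then have "is_bit (last bs)" "last bs = last u" using bs u by simp_all
    then show ?thesis using assms(2) by (simp add: is_bit_def)
  qed simp
  then obtain n where n: "bs = enc_nat n" using ex_enc_nat[OF bs] by blast
  obtain l where "a # bs = enc_lit l"
    using a n enc_lit.simps[of n] by metis
  then have "u = enc_clauses cls @ enc_lits (ls @ [l])" using u by simp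
  then show ?thesis by (rule that)
qed

lemma in_lit_ClauseEnd: "in_lit u \<Longrightarrow> last u \<noteq> Bit0 \<Longrightarrow> at_clause (u @ [ClauseEnd])"
proof -
  assume "in_lit u" "last u \<noteq> Bit0"
  then obtain cls ls where u: "u = enc_clauses cls @ enc_lits ls" by (rule in_lit_complete)
  then have "u @ [ClauseEnd] = enc_clauses (cls @ [ls])" by (simp add: enc_clause_def)
  then show ?thesis unfolding at_clause_def by blast
qed

lemma in_lit_sign: "in_lit u \<Longrightarrow> last u \<noteq> Bit0 \<Longrightarrow> a = Plus \<or> a = Minus \<Longrightarrow> in_lit (u @ [a])"
proof -
  assume a: "a = Plus \<or> a = Minus" and "in_lit u" "last u \<noteq> Bit0"
  then obtain cls ls where u: "u = enc_clauses cls @ enc_lits ls" by (elim in_lit_complete)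
  then have "u @ [a] = enc_clauses cls @ enc_lits ls @ a # []" by simp
  then show ?thesis unfolding in_lit_def using a by (metis empty_iff list.set(1))
qed

lemma in_lit_bit: "in_lit u \<Longrightarrow> is_bit b \<Longrightarrow> in_lit (u @ [b])"
proof -
  assume "in_lit u" and b: "is_bit b"
  then obtain cls ls a bs where u: "u = enc_clauses cls @ enc_lits ls @ a # bs"
    and a: "a = Plus \<or> a = Minus" and bs: "\<forall>b\<in>set bs. is_bit b"
    unfolding in_lit_def by blast
  have "u @ [b] = enc_clauses cls @ enc_lits ls @ a # (bs @ [b])" using u by simp
  moreover have "\<forall>b\<in>set (bs @ [b]). is_bit b" using bs b by simp
  ultimately show ?thesis unfolding in_lit_def using a by blast
qed

lemma in_var_bit: "in_var u \<Longrightarrow> is_bit b \<Longrightarrow> in_var (u @ [b])"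
proof -
  assume "in_var u" and b: "is_bit b"
  then obtain cls bs where u: "u = enc_clauses cls @ Sep # bs" and bs: "\<forall>b\<in>set bs. is_bit b"
    unfolding in_var_def by blast
  have "u @ [b] = enc_clauses cls @ Sep # (bs @ [b])" using u by simp
  moreover have "\<forall>b\<in>set (bs @ [b]). is_bit b" using bs b by simp
  ultimately show ?thesis unfolding in_var_def by blast
qed

lemma in_bound_bit: "in_bound u \<Longrightarrow> is_bit b \<Longrightarrow> in_bound (u @ [b])"
proof -
  assume "in_bound u" and b: "is_bit b"
  then obtain cls x bs where u: "u = enc_clauses cls @ Sep # enc_nat x @ Sep # bs"
    and bs: "\<forall>b\<in>set bs. is_bit b"
    unfolding in_bound_def by blast
  have "u @ [b] = enc_clauses cls @ Sep # enc_nat x @ Sep # (bs @ [b])" using u by simp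
  moreover have "\<forall>b\<in>set (bs @ [b]). is_bit b" using bs b by simp
  ultimately show ?thesis unfolding in_bound_def by blast
qed

lemma last_bits:
  assumes "\<forall>b\<in>set bs. is_bit b" "last (c # bs) \<noteq> Bit0"
  shows "\<exists>n. bs = enc_nat n"
proof (rule ex_enc_nat[OF assms(1)])
  show "bs = [] \<or> last bs = Bit1"
    using assms last_in_set[of bs] by (auto simp: is_bit_def split: if_splits)
qed

lemma in_var_Sep: "in_var u \<Longrightarrow> last u \<noteq> Bit0 \<Longrightarrow> in_bound (u @ [Sep])"
proof -
  assume "in_var u" and l: "last u \<noteq> Bit0"
  then obtain cls bs where u: "u = enc_clauses cls @ Sep # bs" and bs: "\<forall>b\<in>set bs. is_bit b"
    unfolding in_var_def by blast
  obtain x where "bs = enc_nat x" using last_bits[OF bs, of Sep] l u by auto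
  then have "u @ [Sep] = enc_clauses cls @ Sep # enc_nat x @ Sep # []" using u by simp
  then show ?thesis unfolding in_bound_def by (metis empty_iff list.set(1))
qed

text \<open>Soundness of the automaton by induction on the prefix read so far. Nothing is claimed
  for \<open>ClauseEnd\<close>, the absorbing error state.\<close>

lemma sections_sound:
  "(head_opt (sections (rev u)) \<in> {None, Some Plus} \<longrightarrow> at_clause u \<or> in_lit u) \<and>
   (head_opt (sections (rev u)) = Some Sep \<longrightarrow> in_var u) \<and>
   (head_opt (sections (rev u)) = Some Minus \<longrightarrow> in_bound u)"
proof (induction u rule: rev_induct)
  case Nil
  have "at_clause []" unfolding at_clause_def by (intro exI[of _ "[]"]) simp
  then show ?case by simp
next
  case (snoc a u)
  let ?sec = "head_opt (sections (rev u))"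
  have new: "head_opt (sections (rev (u @ [a]))) = Some (next_section ?sec (head_opt (rev u)) a)" by simp
  have prev: "head_opt (rev u) = (if u = [] then None else Some (last u))" by (rule head_opt_rev)
  consider "?sec = None \<or> ?sec = Some Plus" | "?sec = Some Sep" | "?sec = Some Minus" |
    "?sec \<noteq> None" "?sec \<noteq> Some Plus" "?sec \<noteq> Some Sep" "?sec \<noteq> Some Minus" by blast
  then show ?case
  proof cases
    case 1
    then have ih: "at_clause u \<or> in_lit u" using snoc by auto
    show ?thesis
    proof (cases "at_clause u")
      case True
      then have p: "head_opt (rev u) = None \<or> head_opt (rev u) = Some ClauseEnd"
        using at_clause_prev[OF True] prev by auto
      show ?thesis
        using 1 p at_clause_Sep[OF True] at_clause_ClauseEnd[OF True] at_clause_sign[OF True, of a]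
        unfolding new by (cases a) (auto simp: next_section_def is_bit_def)
    next
      case False
      then have il: "in_lit u" using ih by blast
      then have p: "head_opt (rev u) = Some (last u)" "last u \<noteq> ClauseEnd"
        using in_lit_prev[OF il] prev by auto
      show ?thesis
        using 1 p in_lit_bit[OF il, of a] in_lit_ClauseEnd[OF il] in_lit_sign[OF il, of a]
        unfolding new by (cases a) (auto simp: next_section_def is_bit_def)
    qed
  next
    case 2
    then have iv: "in_var u" using snoc by simp
    then have "u \<noteq> []" by (auto simp: in_var_def)
    then have p: "head_opt (rev u) = Some (last u)" using prev by simp
    show ?thesis using 2 p in_var_bit[OF iv, of a] in_var_Sep[OF iv]
      unfolding new by (cases a) (auto simp: next_section_def is_bit_def)
  next
    case 3
    then have ib: "in_bound u" using snoc by simp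
    show ?thesis using 3 in_bound_bit[OF ib, of a]
      unfolding new by (auto simp: next_section_def)
  next
    case 4
    then obtain c where c: "?sec = Some c" by blast
    then show ?thesis using 4 unfolding new c by (simp add: next_section_def)
  qed
qed

lemma sections_bits:
  assumes "\<forall>b\<in>set bs. is_bit b"
  shows "head_opt (sections qs) = Some Plus \<Longrightarrow> head_opt qs \<notin> {None, Some ClauseEnd} \<Longrightarrow>
      head_opt (sections (rev bs @ qs)) = Some Plus"
    and "head_opt (sections qs) = Some Sep \<Longrightarrow> head_opt (sections (rev bs @ qs)) = Some Sep"
    and "head_opt (sections qs) = Some Minus \<Longrightarrow> head_opt (sections (rev bs @ qs)) = Some Minus"
proof -
  show "head_opt (sections (rev bs @ qs)) = Some Plus"
    if "head_opt (sections qs) = Some Plus" "head_opt qs \<notin> {None, Some ClauseEnd}"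
    using assms that
    by (induction bs arbitrary: qs) (auto simp: next_section_def is_bit_def)
  show "head_opt (sections (rev bs @ qs)) = Some Sep" if "head_opt (sections qs) = Some Sep"
    using assms that by (induction bs arbitrary: qs) (auto simp: next_section_def)
  show "head_opt (sections (rev bs @ qs)) = Some Minus" if "head_opt (sections qs) = Some Minus"
    using assms that by (induction bs arbitrary: qs) (auto simp: next_section_def)
qed

lemma head_opt_append: "head_opt (xs @ ys) = (if xs = [] then head_opt ys else head_opt xs)"
  by (cases xs) auto

lemma head_opt_rev_enc_nat:
  "head_opt (rev (enc_nat n) @ qs) = (if n = 0 then head_opt qs else Some Bit1)"
  by (simp add: head_opt_append head_opt_rev enc_nat_eq_Nil last_enc_nat)

text \<open>A sign or \<open>ClauseEnd\<close> is rejected after \<open>Bit0\<close>. The second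
  conjunct excludes this and is restored by each literal, since a numeral is empty or ends in
  \<open>Bit1\<close>.\<close>

lemma sections_lits:
  assumes "head_opt (sections qs) \<in> {None, Some Plus}" "head_opt qs \<noteq> Some Bit0"
  shows "head_opt (sections (rev (enc_lits ls) @ qs)) \<in> {None, Some Plus} \<and>
    head_opt (rev (enc_lits ls) @ qs) \<noteq> Some Bit0"
  using assms
proof (induction ls arbitrary: qs)
  case (Cons l ls)
  let ?qs = "sign l # qs"
  have s: "sign l \<in> {Plus, Minus}" by (cases l) auto
  then have 1: "head_opt (sections ?qs) = Some Plus"
    using Cons.prems by (auto simp: next_section_def is_bit_def)
  have "head_opt ?qs \<notin> {None, Some ClauseEnd}" using s by auto
  then have 2: "head_opt (sections (rev (enc_nat (var l)) @ ?qs)) = Some Plus"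
    using 1 by (intro sections_bits(1)) (auto intro: enc_nat_bits)
  have 3: "head_opt (rev (enc_nat (var l)) @ ?qs) \<noteq> Some Bit0"
    using s by (auto simp: head_opt_rev_enc_nat)
  show ?case using Cons.IH[of "rev (enc_nat (var l)) @ ?qs"] 2 3 by (simp add: enc_lit_eq)
qed simp

lemma sections_clauses:
  "head_opt (sections (rev (enc_clauses cls))) \<in> {None, Some Plus} \<and>
   head_opt (rev (enc_clauses cls)) \<in> {None, Some ClauseEnd}"
proof (induction cls rule: rev_induct)
  case (snoc c cls)
  define qs where "qs = rev (enc_lits c) @ rev (enc_clauses cls)"
  have "head_opt (sections qs) \<in> {None, Some Plus} \<and> head_opt qs \<noteq> Some Bit0"
    unfolding qs_def using snoc by (intro sections_lits) auto
  moreover have "rev (enc_clauses (cls @ [c])) = ClauseEnd # qs"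
    by (simp add: qs_def enc_clause_def)
  ultimately show ?case by (auto simp: next_section_def is_bit_def)
qed simp

lemma well_formed_iff:
  "well_formed w \<longleftrightarrow> (\<exists>cls x k. k \<ge> 1 \<and> w = enc_instance cls x k)"
proof
  assume wf: "well_formed w"
  then have "in_bound w" using sections_sound[of w] by (simp add: well_formed_def)
  then obtain cls x bs where w: "w = enc_clauses cls @ Sep # enc_nat x @ Sep # bs"
    and bs: "\<forall>b\<in>set bs. is_bit b" unfolding in_bound_def by blast
  have "last w = Bit1" using wf by (simp add: well_formed_def head_opt_rev split: if_splits)
  then have l: "last (Sep # bs) = Bit1" using w by simp
  then obtain k where k: "bs = enc_nat k" using last_bits[OF bs, of Sep] by auto
  then have "k \<noteq> 0" using l enc_nat_eq_Nil[of k] by auto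
  then show "\<exists>cls x k. k \<ge> 1 \<and> w = enc_instance cls x k"
    using w k by (intro exI[of _ cls] exI[of _ x] exI[of _ k]) (simp add: enc_instance_def)
next
  assume "\<exists>cls x k. k \<ge> 1 \<and> w = enc_instance cls x k"
  then obtain cls x k where k: "k \<ge> 1" and w: "w = enc_instance cls x k" by blast
  let ?q0 = "rev (enc_clauses cls)"
  have "head_opt (sections (Sep # ?q0)) = Some Sep"
    using sections_clauses[of cls] by (auto simp: next_section_def)
  then have 1: "head_opt (sections (rev (enc_nat x) @ Sep # ?q0)) = Some Sep" (is "head_opt (sections ?q1) = _")
    by (rule sections_bits(2)[rotated]) (auto intro: enc_nat_bits)
  have "head_opt ?q1 \<noteq> Some Bit0" by (simp add: head_opt_rev_enc_nat)
  then have "head_opt (sections (Sep # ?q1)) = Some Minus"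
    using 1 by (simp add: next_section_def is_bit_def)
  then have "head_opt (sections (rev (enc_nat k) @ Sep # ?q1)) = Some Minus"
    by (rule sections_bits(3)[rotated]) (auto intro: enc_nat_bits)
  moreover have "rev w = rev (enc_nat k) @ Sep # ?q1" by (simp add: w enc_instance_def)
  ultimately show "well_formed w"
    using k by (simp add: well_formed_def head_opt_rev_enc_nat)
qed

section \<open>The decision procedure\<close>

definition rounds :: "sym com" where
  "rounds = Loop (\<lambda>tp. tp rS \<noteq> None) (Pop rS ;; chain_round)"

lemma length_round_update:
  "length (toks (fst (round_update cls x a))) \<le>
     length (toks (fst a)) + length (concat (map enc_clause cls))"
proof -
  obtain ts e f where a: "a = (ts, e, f)" by (metis prod_cases3)
  show ?thesis
    using length_fold_clause_update[of cls "(ts, e)"]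
    by (cases "fold clause_update cls (ts, e)") (simp add: a round_update_def)
qed

text \<open>\<open>n * n + n\<close> bounds the derived list together with the input in any of the
  \<open>n\<close> rounds, and \<open>n * n + n + 1 \<le> (n + 1) ^ 2\<close> turns the fourth power
  into an eighth.\<close>

lemma rounds_time: "(300 * (n * n + n + 1) ^ 4 + 2 + 1) * n + 1 \<le> 303 * (n + 1) ^ 9" for n :: nat
proof -
  define y where "y = (n * n + n + 1) ^ 4"
  define z where "z = (n + 1) ^ 8"
  have "n * n + n + 1 \<le> (n + 1) ^ 2" by (simp add: power2_eq_square)
  then have "y \<le> ((n + 1) ^ 2) ^ 4" unfolding y_def by (rule power_mono) simp
  also have "((n + 1) ^ 2) ^ 4 = z" unfolding z_def power_mult[symmetric] by simp
  finally have "y \<le> z" .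
  moreover have z: "1 \<le> z" unfolding z_def by (rule one_le_power) simp
  ultimately have "300 * y + 2 + 1 \<le> 303 * z" by linarith
  then have "(300 * y + 2 + 1) * n + 1 \<le> 303 * z * n + z" using z by (intro add_mono mult_le_mono1)
  also have "\<dots> \<le> 303 * (z * (n + 1))" by (simp add: algebra_simps)
  also have "z * (n + 1) = (n + 1) ^ 9"
    unfolding z_def using power_Suc2[of "n + 1" 8] by (simp del: power_Suc)
  finally show ?thesis unfolding y_def .
qed

lemma runs_rounds:
  assumes W: "s rW = enc_instance cls x k" and S: "s rS = ss"
    and s: "s rT = []" "s rE = []" "s rF = []" "s rI = []" "idle s"
    and n: "length ss = n" "length (enc_instance cls x k) \<le> n"
    and upd: "(round_update cls x ^^ n) ([], False, False) = (ts, e, f)"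
  shows "runs rounds s (303 * (n + 1) ^ 9)
    (s(rS := [], rT := toks ts, rE := flag e, rF := flag f))"
proof -
  let ?g = "\<lambda>tp. tp rS \<noteq> (None :: sym option)"
  let ?b = "Pop rS ;; chain_round"
  let ?m = "n * n + n"
  define S where "S = (\<lambda>(ts, e, f) ss. s(rS := ss, rT := toks ts, rE := flag e, rF := flag f))"
  \<comment> \<open>Every remaining round reserves \<open>n\<close> symbols of growth for the
    derived list, which starts empty with \<open>n\<close> rounds to go.\<close>
  define Inv :: "nat lit list \<times> bool \<times> bool \<Rightarrow> sym list \<Rightarrow> bool"
    where "Inv = (\<lambda>a ss. length (toks (fst a)) + length ss * n \<le> n * n)"
  have step: "?g (tops (S a (c # ss))) \<and>
      runs ?b (S a (c # ss)) (300 * (?m + 1) ^ 4 + 2) (S (round_update cls x a) ss) \<and>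
      Inv (round_update cls x a) ss"
    if inv: "Inv a (c # ss)" for a c ss
  proof -
    obtain ts e f where a: "a = (ts, e, f)" by (metis prod_cases3)
    obtain ts' e' f' where u: "round_update cls x (ts, e, f) = (ts', e', f')" by (metis prod_cases3)
    have len: "length (toks ts) \<le> n * n" using inv by (simp add: Inv_def a)
    have len: "length (toks ts) + length (enc_instance cls x k) \<le> ?m" using len n(2) by linarith
    have 1: "runs (Pop rS) (S a (c # ss)) 1 (S a ss)"
      by (rule runs_eqI[OF runs_Pop]) (simp_all add: S_def a fun_eq_iff)
    have "runs chain_round (S a ss) (300 * (?m + 1) ^ 4)
        ((S a ss)(rT := toks ts', rE := flag e', rF := flag f'))"
      by (rule runs_chain_round[OF _ _ _ _ _ _ _ u])
        (use W s n(2) len in \<open>simp_all add: S_def a idle_def\<close>)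
    then have 2: "runs chain_round (S a ss) (300 * (?m + 1) ^ 4) (S (round_update cls x a) ss)"
      by (rule runs_eqI) (simp_all add: S_def a u fun_eq_iff)
    have "length (concat (map enc_clause cls)) \<le> n" using n(2) by (simp add: enc_instance_def)
    then have "Inv (round_update cls x a) ss"
      using inv length_round_update[of cls x a] by (simp add: Inv_def)
    moreover have "?g (tops (S a (c # ss)))" by (simp add: S_def a tops_Cons)
    moreover have "runs ?b (S a (c # ss)) (300 * (?m + 1) ^ 4 + 2) (S (round_update cls x a) ss)"
      by (rule runs_eqI[OF runs_Seq[OF 1 2]]) simp_all
    ultimately show ?thesis by blast
  qed
  have stop: "\<not> ?g (tops (S a []))" for a
    by (cases a) (simp add: S_def tops_Nil)
  let ?a = "([], False, False)"
  have "runs (Loop ?g ?b) (S ?a ss) ((300 * (?m + 1) ^ 4 + 2 + 1) * length ss + 1)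
      (S (fold (\<lambda>_. round_update cls x) ss ?a) [])"
    by (rule conjunct1, rule runs_Loop_fold[where Inv = Inv])
      (use step stop n in \<open>blast, blast, simp add: Inv_def toks_Nil\<close>)
  moreover have "fold (\<lambda>_. round_update cls x) ss a = (round_update cls x ^^ length ss) a" for a
    by (induction ss arbitrary: a) (simp_all add: funpow_swap1)
  moreover have "S ?a ss = s" using s S by (simp add: S_def fun_eq_iff toks_Nil flag_def)
  ultimately have 1: "runs rounds s ((300 * (?m + 1) ^ 4 + 2 + 1) * n + 1) (S (ts, e, f) [])"
    unfolding rounds_def using n upd by simp
  show ?thesis by (rule runs_eqI[OF 1 _ rounds_time]) (simp add: S_def)
qed

text \<open>The new state is pushed before the symbol is moved, while the top of \<open>rQ\<close>
  is still the previous symbol.\<close>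

definition parse :: "sym com" where
  "parse = Loop (\<lambda>tp. tp rI \<noteq> None)
     (Push rS (\<lambda>tp. next_section (tp rS) (tp rQ) (the (tp rI))) ;; xfer rI rQ)"

lemma runs_parse:
  "runs parse ((\<lambda>_. [])(rI := w)) (8 * length w + 1)
     ((\<lambda>_. [])(rQ := rev w, rS := sections (rev w)))"
proof -
  let ?g = "\<lambda>tp. tp rI \<noteq> (None :: sym option)"
  let ?b = "Push rS (\<lambda>tp. next_section (tp rS) (tp rQ) (the (tp rI))) ;; xfer rI rQ"
  define S where "S = (\<lambda>qs ys. (\<lambda>_. [])(rI := ys, rQ := qs, rS := sections qs))"
  have step: "?g (tops (S qs (y # ys))) \<and> runs ?b (S qs (y # ys)) 7 (S (y # qs) ys) \<and> True" for qs y ys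
  proof -
    let ?s = "(S qs (y # ys))(rS := sections (y # qs))"
    have 1: "runs (Push rS (\<lambda>tp. next_section (tp rS) (tp rQ) (the (tp rI)))) (S qs (y # ys)) 2 ?s"
      by (rule runs_eqI[OF runs_Push]) (simp_all add: S_def tops_head_opt)
    have 2: "runs (xfer rI rQ) ?s 4 (S (y # qs) ys)"
      by (rule runs_eqI[OF runs_xfer[where x = y and xs = ys]]) (simp_all add: S_def fun_eq_iff)
    have "runs ?b (S qs (y # ys)) 7 (S (y # qs) ys)"
      by (rule runs_eqI[OF runs_Seq[OF 1 2]]) simp_all
    then show ?thesis by (simp add: S_def tops_Cons)
  qed
  have stop: "\<not> ?g (tops (S qs []))" for qs by (simp add: S_def tops_Nil)
  have "runs (Loop ?g ?b) (S [] w) ((7 + 1) * length w + 1) (S (fold (#) w []) [])"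
    by (rule conjunct1, rule runs_Loop_fold[where Inv = "\<lambda>_ _. True"]) (use step stop in blast)+
  moreover have "fold (#) w [] = rev w" using fold_Cons_rev[of w] by (simp add: fun_eq_iff)
  moreover have "S [] w = (\<lambda>_. [])(rI := w)" by (simp add: S_def fun_eq_iff)
  moreover have "S (rev w) [] = (\<lambda>_. [])(rQ := rev w, rS := sections (rev w))"
    by (simp add: S_def fun_eq_iff)
  ultimately have "runs (Loop ?g ?b) ((\<lambda>_. [])(rI := w)) ((7 + 1) * length w + 1)
      ((\<lambda>_. [])(rQ := rev w, rS := sections (rev w)))" by simp
  then show ?thesis
    unfolding parse_def
    by (rule runs_eqI) simp_all
qed


text \<open>\<open>rQ\<close> holds the input reversed, so one move restores it on
  \<open>rW\<close>. On ill-formed input \<open>rF\<close> stays empty and the final test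
  rejects.\<close>

definition decide :: "sym com" where
  "decide = parse ;;
     Cond (\<lambda>tp. tp rS = Some Minus \<and> tp rQ = Some Bit1) (move rQ rW ;; rounds) Skip"

lemma length_sections: "length (sections qs) = length qs"
  by (induction qs) simp_all

lemma runs_decide_ill_formed:
  assumes "\<not> well_formed w"
  shows "runs decide ((\<lambda>_. [])(rI := w)) (400 * (length w + 1) ^ 9)
    ((\<lambda>_. [])(rQ := rev w, rS := sections (rev w)))"
proof -
  let ?s = "(\<lambda>_. [])(rQ := rev w, rS := sections (rev w))"
  let ?g = "\<lambda>tp. tp rS = Some Minus \<and> tp rQ = Some Bit1"
  have g: "\<not> ?g (tops ?s)" using assms by (simp add: tops_head_opt well_formed_def)
  have "length w + 1 \<le> (length w + 1) ^ 9" by (rule self_le_power) simp_all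
  then have t: "8 * length w + 1 + (1 + 1) + 1 \<le> 400 * (length w + 1) ^ 9" by simp
  show ?thesis
    unfolding decide_def
    by (rule runs_eqI[OF runs_Seq[OF runs_parse runs_CondF[of ?g, OF g runs_Skip]] refl t])
qed

lemma runs_decide_well_formed:
  assumes wf: "well_formed w" and w: "w = enc_instance cls x k"
    and upd: "(round_update cls x ^^ length w) ([], False, False) = (ts, e, f)"
  shows "runs decide ((\<lambda>_. [])(rI := w)) (400 * (length w + 1) ^ 9)
    ((\<lambda>_. [])(rW := w, rT := toks ts, rE := flag e, rF := flag f))"
proof -
  let ?n = "length w"
  let ?s = "(\<lambda>_. [])(rQ := rev w, rS := sections (rev w))"
  let ?g = "\<lambda>tp. tp rS = Some Minus \<and> tp rQ = Some Bit1"
  have g: "?g (tops ?s)" using wf by (simp add: tops_head_opt well_formed_def)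
  let ?s1 = "(\<lambda>_. [])(rW := w, rS := sections (rev w))"
  have 1: "runs (move rQ rW) ?s (5 * ?n + 1) ?s1"
    by (rule runs_eqI[OF runs_move]) (simp_all add: fun_eq_iff)
  have 2: "runs rounds ?s1 (303 * (?n + 1) ^ 9) (?s1(rS := [], rT := toks ts, rE := flag e, rF := flag f))"
    by (rule runs_rounds[where cls = cls and x = x and k = k and ss = "sections (rev w)", OF _ _ _ _ _ _ _ _ _ upd])
      (simp_all add: w[symmetric] idle_def length_sections)
  have "?n + 1 \<le> (?n + 1) ^ 9" by (rule self_le_power) simp_all
  then have t: "8 * ?n + 1 + (5 * ?n + 1 + 303 * (?n + 1) ^ 9 + 1 + 1) + 1 \<le> 400 * (?n + 1) ^ 9" by simp
  show ?thesis
    unfolding decide_def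
    by (rule runs_eqI[OF runs_Seq[OF runs_parse runs_CondT[of ?g, OF g runs_Seq[OF 1 2]]] _ t])
      (simp add: fun_eq_iff)
qed

text \<open>Why the stack of parser states can count the rounds: it holds one entry per input
  symbol, more than there are clauses.\<close>

lemma length_enc_instance: "length cls < length (enc_instance cls x k)"
proof -
  have "length cls \<le> length (concat (map enc_clause cls))"
    by (induction cls) (simp_all add: enc_clause_def)
  then show ?thesis by (simp add: enc_instance_def)
qed

abbreviation (input) "accepting \<equiv> \<lambda>tp. tp rF \<noteq> None \<and> tp rE = None"

lemma decide_correct:
  "\<exists>s. runs decide ((\<lambda>_. [])(rI := w)) (400 * (length w + 1) ^ 9) s \<and>
     (accepting (tops s) \<longleftrightarrow> w \<in> Iterative_Local_Backbone definite_Horn)"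
proof -
  let ?L = "Iterative_Local_Backbone definite_Horn"
  define good where "good = (\<lambda>cls x k. formula_of cls \<in> definite_Horn \<and> x \<in> Vars (formula_of cls) \<and>
      iterative_k_backbone k (formula_of cls) x)"
  have L: "w \<in> ?L \<longleftrightarrow> (\<exists>cls x k. w = enc_instance cls x k \<and> k \<ge> 1 \<and> good cls x k)"
    unfolding Iterative_Local_Backbone_def good_def definite_Horn_def by blast
  show ?thesis
  proof (cases "well_formed w")
    case False
    then have "w \<notin> ?L" using L well_formed_iff by blast
    then show ?thesis
      using runs_decide_ill_formed[OF False]
      by (intro exI conjI) (assumption, simp add: tops_Nil)
  next
    case True
    \<comment> \<open>The choice replaces injectivity of the encoding: if \<open>w\<close> is in the
      language, a witness of this is taken; otherwise any decoding will do, since a good one would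
      put \<open>w\<close> into the language.\<close>
    then obtain cls x k where w: "w = enc_instance cls x k" and k: "k \<ge> 1"
      and g: "w \<in> ?L \<longleftrightarrow> good cls x k"
      using L well_formed_iff by metis
    obtain ts e f where u: "(round_update cls x ^^ length w) ([], False, False) = (ts, e, f)"
      by (metis prod_cases3)
    have "length cls < length w" using w length_enc_instance by simp
    then have "f \<and> \<not> e \<longleftrightarrow> good cls x k"
      unfolding good_def by (intro rounds_correct[OF u]) (use k in simp_all)
    then show ?thesis
      using g runs_decide_well_formed[OF True w u]
      by (intro exI conjI) (assumption, auto simp: tops_None flag_def)
  qed
qed

theorem theorem6:
  "Iterative_Local_Backbone definite_Horn \<in> polynomial_time"
\<comment> \<open>The polynomial is \<open>401 * (n + 1) ^ 9\<close>: 400 for the program, and one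
  more to absorb the halting step.\<close>
proof (rule polynomial_timeI[where c = decide and acc = accepting and p = "[:401:] * [:1, 1:] ^ 9"])
  fix w
  obtain s where r: "runs decide ((\<lambda>_. [])(rI := w)) (400 * (length w + 1) ^ 9) s"
    and acc: "accepting (tops s) \<longleftrightarrow> w \<in> Iterative_Local_Backbone definite_Horn"
    using decide_correct[of w] by (elim exE conjE)
  obtain t where t: "t \<le> 400 * (length w + 1) ^ 9" "exec decide ((\<lambda>_. [])(rI := w)) t s"
    using r by (auto simp: runs_def)
  have "poly ([:401:] * [:1, 1:] ^ 9) (length w) = 401 * (length w + 1) ^ 9"
    by (simp add: poly_power)
  moreover have "1 \<le> (length w + 1) ^ 9" by simp
  ultimately have "t + 1 \<le> poly ([:401:] * [:1, 1:] ^ 9) (length w)" using t(1) by linarith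
  then show "\<exists>t s. exec decide ((\<lambda>_. [])(0 := w)) t s \<and>
      t + 1 \<le> poly ([:401:] * [:1, 1:] ^ 9) (length w) \<and>
      (accepting (tops s) \<longleftrightarrow> w \<in> Iterative_Local_Backbone definite_Horn)"
    using t(2) acc by blast
qed

end
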